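(* Let $C$ be a commutative ring in which $2$ is invertible, let $\epsilon\in\{1,-1\}$, let $z_0^{(\ell)}\in C$ for $\ell\in\mathbb{Z}_{\ge0}$, and let $i\ge1$ be an integer. Let $\mathcal{W}_{i+1}$ be the degenerate affine BMW algebra (on $k=i+1$ strands) over $C$ with parameters $\epsilon$ and $z_0^{(\ell)}$. Let $u$ be a variable and put $u_i^+=\frac{1}{u-y_i}$ and $u_{i+1}^+=\frac{1}{u-y_{i+1}}$. Then the following two identities hold in $\mathcal{W}_{i+1}[[u^{-1}]]$: $$\left(e_i\frac{1}{u-y_{i+1}}-t_{s_i}-\frac{1}{2u-(y_i+y_{i+1})}\right)\left(e_i\frac{1}{u-y_i}+t_{s_i}-\frac{1}{2u-(y_i+y_{i+1})}\right)=\frac{-(2u-(y_i+y_{i+1})+1)(2u-(y_i+y_{i+1})-1)}{(2u-(y_i+y_{i+1}))^2},$$ and $$\left(u_{i+1}^++t_{s_i}-e_i\frac{1}{2u-(y_i+y_{i+1})}\right)-u_i^+\left(u_{i+1}^++t_{s_i}-e_i\frac{1}{2u-(y_i+y_{i+1})}\right)u_i^+$$ $$=\left(t_{s_i}u_i^+t_{s_i}+t_{s_i}-e_i\frac{1}{2u-(y_i+y_{i+1})}\right)-u_{i+1}^+\left(e_iu_i^+e_i+\epsilon e_i-e_i\frac{1}{2u-(y_i+y_{i+1})}\right)u_{i+1}^+.$$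
   Context: Let $S_k$ be the symmetric group on $\{1,\ldots,k\}$ and $s_j$ the transposition switching $j$ and $j+1$. The degenerate affine braid algebra $\mathcal{B}_k$ is the associative unital $C$-algebra generated by $t_w$ ($w\in S_k$), $\kappa_0,\kappa_1$, and $y_1,\ldots,y_k$, with relations $$t_wt_v=t_{wv},\quad y_iy_j=y_jy_i,\quad \kappa_0\kappa_1=\kappa_1\kappa_0,\quad \kappa_0y_i=y_i\kappa_0,\quad \kappa_1y_i=y_i\kappa_1,$$ $$\kappa_0t_{s_i}=t_{s_i}\kappa_0,\quad \kappa_1t_{s_1}\kappa_1t_{s_1}=t_{s_1}\kappa_1t_{s_1}\kappa_1,\quad \kappa_1t_{s_j}=t_{s_j}\kappa_1\ (j\ne1),$$ $$t_{s_i}(y_i+y_{i+1})=(y_i+y_{i+1})t_{s_i},\quad y_jt_{s_i}=t_{s_i}y_j\ (j\ne i,i+1),$$ $$t_{s_i}t_{s_{i+1}}\gamma_{i,i+1}t_{s_{i+1}}t_{s_i}=\gamma_{i+1,i+2}\ (1\le i\le k-2),\quad\text{where } \gamma_{i,i+1}=y_{i+1}-t_{s_i}y_it_{s_i}.$$ Define $e_i\in\mathcal{B}_k$, for $1\le i\le k-1$, by $t_{s_i}y_i=y_{i+1}t_{s_i}-(1-e_i)$. The degenerate affine BMW algebra $\mathcal{W}_k$ is the quotient of $\mathcal{B}_k$ by the relations (for all indices for which they make sense) $$e_it_{s_i}=t_{s_i}e_i=\epsilon e_i,\qquad e_it_{s_{i-1}}e_i=e_it_{s_{i+1}}e_i=\epsilon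 e_i,$$ $$e_1y_1^{\ell}e_1=z_0^{(\ell)}e_1\ (\ell\in\mathbb{Z}_{\ge0}),\qquad e_i(y_i+y_{i+1})=0=(y_i+y_{i+1})e_i.$$ The variable $u$ commutes with everything, and rational expressions are expanded in $u^{-1}$: $\frac{1}{u-a}=\sum_{\ell\ge1}a^{\ell-1}u^{-\ell}$ and $\frac{1}{2u-a}=\sum_{\ell\ge1}2^{-\ell}a^{\ell-1}u^{-\ell}$. *)

theory Defs
  imports "HOL-Algebra.QuotRing" "HOL-Algebra.Sym_Groups"
begin

section \<open>Free associative algebras and presentations\<close>

text \<open>
  The free associative unital algebra on a set \<open>S\<close> over a commutative ring \<open>C\<close>: finitely supported
  \<open>C\<close>-valued functions on the words over \<open>S\<close>, multiplied by concatenation of words.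
\<close>

definition free_algebra :: "('c, 'm) ring_scheme \<Rightarrow> 'g set \<Rightarrow> ('g list \<Rightarrow> 'c) ring" where
  "free_algebra C S =
    \<lparr>carrier = {p. (\<forall>w. p w \<in> carrier C) \<and> finite {w. p w \<noteq> \<zero>\<^bsub>C\<^esub>} \<and> {w. p w \<noteq> \<zero>\<^bsub>C\<^esub>} \<subseteq> lists S},
     monoid.mult = (\<lambda>p q w. \<Oplus>\<^bsub>C\<^esub>n\<in>{..length w}. p (take n w) \<otimes>\<^bsub>C\<^esub> q (drop n w)),
     one = (\<lambda>w. if w = [] then \<one>\<^bsub>C\<^esub> else \<zero>\<^bsub>C\<^esub>),
     zero = (\<lambda>w. \<zero>\<^bsub>C\<^esub>),
     add = (\<lambda>p q w. p w \<oplus>\<^bsub>C\<^esub> q w)\<rparr>"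

definition free_gen :: "('c, 'm) ring_scheme \<Rightarrow> 'g \<Rightarrow> 'g list \<Rightarrow> 'c" where
  "free_gen C g = (\<lambda>w. if w = [g] then \<one>\<^bsub>C\<^esub> else \<zero>\<^bsub>C\<^esub>)"

definition free_scalar :: "('c, 'm) ring_scheme \<Rightarrow> 'c \<Rightarrow> 'g list \<Rightarrow> 'c" where
  "free_scalar C c = (\<lambda>w. if w = [] then c else \<zero>\<^bsub>C\<^esub>)"

text \<open>A pair \<open>(a, b)\<close> in a set of relations stands for the relation \<open>a = b\<close>.\<close>

definition rel_ideal :: "('a, 'm) ring_scheme \<Rightarrow> ('a \<times> 'a) set \<Rightarrow> 'a set" where
  "rel_ideal R rels = Idl\<^bsub>R\<^esub> ((\<lambda>(a, b). a \<ominus>\<^bsub>R\<^esub> b) ` rels)"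

definition rel_quot :: "('a, 'm) ring_scheme \<Rightarrow> ('a \<times> 'a) set \<Rightarrow> 'a set ring" where
  "rel_quot R rels = R Quot rel_ideal R rels"

definition rel_class :: "('a, 'm) ring_scheme \<Rightarrow> ('a \<times> 'a) set \<Rightarrow> 'a \<Rightarrow> 'a set" where
  "rel_class R rels x = rel_ideal R rels +>\<^bsub>R\<^esub> x"


section \<open>The degenerate affine braid algebra\<close>

datatype braid_gen = T "nat \<Rightarrow> nat" | Kappa0 | Kappa1 | Y nat

definition braid_gens :: "nat \<Rightarrow> braid_gen set" where
  "braid_gens k = T ` carrier (sym_group k) \<union> {Kappa0, Kappa1} \<union> Y ` {1..k}"

abbreviation adj :: "nat \<Rightarrow> nat \<Rightarrow> nat" where
  "adj j \<equiv> transpose j (j + 1)"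

context
  fixes R :: "('a, 'm) ring_scheme" (structure)
begin

definition gamma :: "((nat \<Rightarrow> nat) \<Rightarrow> 'a) \<Rightarrow> (nat \<Rightarrow> 'a) \<Rightarrow> nat \<Rightarrow> 'a" where
  "gamma t y i = y (i + 1) \<ominus> t (adj i) \<otimes> y i \<otimes> t (adj i)"

text \<open>
  The relations, for elements \<open>t w\<close>, \<open>\<kappa>0\<close>, \<open>\<kappa>1\<close>, \<open>y j\<close> of an arbitrary ring. The relation
  \<open>t id = 1\<close> is not listed; for \<open>k \<ge> 2\<close> it follows in the quotient \<open>BMW_algebra\<close> below.
\<close>

inductive_set braid_rels ::
    "nat \<Rightarrow> ((nat \<Rightarrow> nat) \<Rightarrow> 'a) \<Rightarrow> 'a \<Rightarrow> 'a \<Rightarrow> (nat \<Rightarrow> 'a) \<Rightarrow> ('a \<times> 'a) set"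
  for k :: nat and t :: "(nat \<Rightarrow> nat) \<Rightarrow> 'a" and \<kappa>0 \<kappa>1 :: 'a and y :: "nat \<Rightarrow> 'a" where
  t_t: "\<lbrakk>w \<in> carrier (sym_group k); v \<in> carrier (sym_group k)\<rbrakk>
    \<Longrightarrow> (t w \<otimes> t v, t (w \<otimes>\<^bsub>sym_group k\<^esub> v)) \<in> braid_rels k t \<kappa>0 \<kappa>1 y"
| y_y: "\<lbrakk>i \<in> {1..k}; j \<in> {1..k}\<rbrakk> \<Longrightarrow> (y i \<otimes> y j, y j \<otimes> y i) \<in> braid_rels k t \<kappa>0 \<kappa>1 y"
| k0_k1: "(\<kappa>0 \<otimes> \<kappa>1, \<kappa>1 \<otimes> \<kappa>0) \<in> braid_rels k t \<kappa>0 \<kappa>1 y"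
| k0_y: "i \<in> {1..k} \<Longrightarrow> (\<kappa>0 \<otimes> y i, y i \<otimes> \<kappa>0) \<in> braid_rels k t \<kappa>0 \<kappa>1 y"
| k1_y: "i \<in> {1..k} \<Longrightarrow> (\<kappa>1 \<otimes> y i, y i \<otimes> \<kappa>1) \<in> braid_rels k t \<kappa>0 \<kappa>1 y"
| k0_t: "i \<in> {1..<k} \<Longrightarrow> (\<kappa>0 \<otimes> t (adj i), t (adj i) \<otimes> \<kappa>0) \<in> braid_rels k t \<kappa>0 \<kappa>1 y"
| k1_t1: "1 < k \<Longrightarrow>
    (\<kappa>1 \<otimes> t (adj 1) \<otimes> \<kappa>1 \<otimes> t (adj 1), t (adj 1) \<otimes> \<kappa>1 \<otimes> t (adj 1) \<otimes> \<kappa>1) \<in> braid_rels k t \<kappa>0 \<kappa>1 y"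
| k1_t: "\<lbrakk>j \<in> {1..<k}; j \<noteq> 1\<rbrakk>
    \<Longrightarrow> (\<kappa>1 \<otimes> t (adj j), t (adj j) \<otimes> \<kappa>1) \<in> braid_rels k t \<kappa>0 \<kappa>1 y"
| t_ysum: "i \<in> {1..<k} \<Longrightarrow>
    (t (adj i) \<otimes> (y i \<oplus> y (i + 1)), (y i \<oplus> y (i + 1)) \<otimes> t (adj i)) \<in> braid_rels k t \<kappa>0 \<kappa>1 y"
| y_t: "\<lbrakk>i \<in> {1..<k}; j \<in> {1..k}; j \<noteq> i; j \<noteq> i + 1\<rbrakk>
    \<Longrightarrow> (y j \<otimes> t (adj i), t (adj i) \<otimes> y j) \<in> braid_rels k t \<kappa>0 \<kappa>1 y"
| t_gamma: "\<lbrakk>1 \<le> i; i + 2 \<le> k\<rbrakk>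
    \<Longrightarrow> (t (adj i) \<otimes> t (adj (i + 1)) \<otimes> gamma t y i \<otimes> t (adj (i + 1)) \<otimes> t (adj i), gamma t y (i + 1))
        \<in> braid_rels k t \<kappa>0 \<kappa>1 y"

end

definition free_braid_rels ::
    "('c, 'm) ring_scheme \<Rightarrow> nat \<Rightarrow> ((braid_gen list \<Rightarrow> 'c) \<times> (braid_gen list \<Rightarrow> 'c)) set" where
  "free_braid_rels C k =
    braid_rels (free_algebra C (braid_gens k)) k (\<lambda>w. free_gen C (T w)) (free_gen C Kappa0)
      (free_gen C Kappa1) (\<lambda>j. free_gen C (Y j))"

definition braid_algebra :: "('c, 'm) ring_scheme \<Rightarrow> nat \<Rightarrow> (braid_gen list \<Rightarrow> 'c) set ring" where
  "braid_algebra C k = rel_quot (free_algebra C (braid_gens k)) (free_braid_rels C k)"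

definition braid_class ::
    "('c, 'm) ring_scheme \<Rightarrow> nat \<Rightarrow> (braid_gen list \<Rightarrow> 'c) \<Rightarrow> (braid_gen list \<Rightarrow> 'c) set" where
  "braid_class C k = rel_class (free_algebra C (braid_gens k)) (free_braid_rels C k)"

definition braid_t :: "('c, 'm) ring_scheme \<Rightarrow> nat \<Rightarrow> (nat \<Rightarrow> nat) \<Rightarrow> (braid_gen list \<Rightarrow> 'c) set" where
  "braid_t C k w = braid_class C k (free_gen C (T w))"

definition braid_y :: "('c, 'm) ring_scheme \<Rightarrow> nat \<Rightarrow> nat \<Rightarrow> (braid_gen list \<Rightarrow> 'c) set" where
  "braid_y C k j = braid_class C k (free_gen C (Y j))"

definition braid_scalar :: "('c, 'm) ring_scheme \<Rightarrow> nat \<Rightarrow> 'c \<Rightarrow> (braid_gen list \<Rightarrow> 'c) set" where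
  "braid_scalar C k c = braid_class C k (free_scalar C c)"

text \<open>\<open>t\<^sub>i y\<^sub>i = y\<^sub>i\<^sub>+\<^sub>1 t\<^sub>i - (1 - e\<^sub>i)\<close>, where \<open>t\<^sub>i\<close> belongs to the \<open>i\<close>-th adjacent transposition, solved for \<open>e\<^sub>i\<close>.\<close>

definition braid_e :: "('c, 'm) ring_scheme \<Rightarrow> nat \<Rightarrow> nat \<Rightarrow> (braid_gen list \<Rightarrow> 'c) set" where
  "braid_e C k i =
    (let B = braid_algebra C k; t = braid_t C k (adj i) in
      \<one>\<^bsub>B\<^esub> \<ominus>\<^bsub>B\<^esub> (braid_y C k (i + 1) \<otimes>\<^bsub>B\<^esub> t \<ominus>\<^bsub>B\<^esub> t \<otimes>\<^bsub>B\<^esub> braid_y C k i))"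


section \<open>The degenerate affine BMW algebra\<close>

context
  fixes R :: "('a, 'm) ring_scheme" (structure)
begin

text \<open>Here \<open>s j\<close> stands for \<open>t\<close> at the \<open>j\<close>-th adjacent transposition and \<open>\<epsilon>\<close>, \<open>z l\<close> are scalars in \<open>R\<close>.\<close>

inductive_set BMW_rels ::
    "nat \<Rightarrow> 'a \<Rightarrow> (nat \<Rightarrow> 'a) \<Rightarrow> (nat \<Rightarrow> 'a) \<Rightarrow> (nat \<Rightarrow> 'a) \<Rightarrow> (nat \<Rightarrow> 'a) \<Rightarrow> ('a \<times> 'a) set"
  for k :: nat and \<epsilon> :: 'a and z s y e :: "nat \<Rightarrow> 'a" where
  e_t: "i \<in> {1..<k} \<Longrightarrow> (e i \<otimes> s i, \<epsilon> \<otimes> e i) \<in> BMW_rels k \<epsilon> z s y e"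
| t_e: "i \<in> {1..<k} \<Longrightarrow> (s i \<otimes> e i, \<epsilon> \<otimes> e i) \<in> BMW_rels k \<epsilon> z s y e"
| e_t_pred_e: "\<lbrakk>i \<in> {1..<k}; i - 1 \<in> {1..<k}\<rbrakk>
    \<Longrightarrow> (e i \<otimes> s (i - 1) \<otimes> e i, \<epsilon> \<otimes> e i) \<in> BMW_rels k \<epsilon> z s y e"
| e_t_succ_e: "\<lbrakk>i \<in> {1..<k}; i + 1 \<in> {1..<k}\<rbrakk>
    \<Longrightarrow> (e i \<otimes> s (i + 1) \<otimes> e i, \<epsilon> \<otimes> e i) \<in> BMW_rels k \<epsilon> z s y e"
| e_y_e: "1 < k \<Longrightarrow> (e 1 \<otimes> y 1 [^] (l::nat) \<otimes> e 1, z l \<otimes> e 1) \<in> BMW_rels k \<epsilon> z s y e"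
| e_ysum: "i \<in> {1..<k} \<Longrightarrow> (e i \<otimes> (y i \<oplus> y (i + 1)), \<zero>) \<in> BMW_rels k \<epsilon> z s y e"
| ysum_e: "i \<in> {1..<k} \<Longrightarrow> ((y i \<oplus> y (i + 1)) \<otimes> e i, \<zero>) \<in> BMW_rels k \<epsilon> z s y e"

end

definition braid_BMW_rels ::
    "('c, 'm) ring_scheme \<Rightarrow> 'c \<Rightarrow> (nat \<Rightarrow> 'c) \<Rightarrow> nat \<Rightarrow>
      ((braid_gen list \<Rightarrow> 'c) set \<times> (braid_gen list \<Rightarrow> 'c) set) set" where
  "braid_BMW_rels C \<epsilon> z k =
    BMW_rels (braid_algebra C k) k (braid_scalar C k \<epsilon>) (\<lambda>l. braid_scalar C k (z l))
      (\<lambda>j. braid_t C k (adj j)) (braid_y C k) (braid_e C k)"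

definition BMW_algebra ::
    "('c, 'm) ring_scheme \<Rightarrow> 'c \<Rightarrow> (nat \<Rightarrow> 'c) \<Rightarrow> nat \<Rightarrow> (braid_gen list \<Rightarrow> 'c) set set ring" where
  "BMW_algebra C \<epsilon> z k = rel_quot (braid_algebra C k) (braid_BMW_rels C \<epsilon> z k)"

definition BMW_class ::
    "('c, 'm) ring_scheme \<Rightarrow> 'c \<Rightarrow> (nat \<Rightarrow> 'c) \<Rightarrow> nat \<Rightarrow>
      (braid_gen list \<Rightarrow> 'c) set \<Rightarrow> (braid_gen list \<Rightarrow> 'c) set set" where
  "BMW_class C \<epsilon> z k = rel_class (braid_algebra C k) (braid_BMW_rels C \<epsilon> z k)"


section \<open>Series in the inverse of a central variable\<close>

text \<open>
  The ring of Laurent series in \<open>u\<^sup>-\<^sup>1\<close> over a ring \<open>R\<close>; \<open>f n\<close> is the coefficient of \<open>u\<^sup>-\<^sup>n\<close>.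
  It contains both \<open>R[[u\<^sup>-\<^sup>1]]\<close> (the series vanishing at all \<open>n < 0\<close>) and the polynomials in \<open>u\<close>
  that occur as numerators of rational expressions.
\<close>

definition laurent_ring :: "('a, 'm) ring_scheme \<Rightarrow> (int \<Rightarrow> 'a) ring" where
  "laurent_ring R =
    \<lparr>carrier = {f. (\<forall>n. f n \<in> carrier R) \<and> (\<exists>N. \<forall>n<N. f n = \<zero>\<^bsub>R\<^esub>)},
     monoid.mult = (\<lambda>f g n. \<Oplus>\<^bsub>R\<^esub>m\<in>{m. f m \<noteq> \<zero>\<^bsub>R\<^esub> \<and> g (n - m) \<noteq> \<zero>\<^bsub>R\<^esub>}. f m \<otimes>\<^bsub>R\<^esub> g (n - m)),
     one = (\<lambda>n. if n = 0 then \<one>\<^bsub>R\<^esub> else \<zero>\<^bsub>R\<^esub>),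
     zero = (\<lambda>n. \<zero>\<^bsub>R\<^esub>),
     add = (\<lambda>f g n. f n \<oplus>\<^bsub>R\<^esub> g n)\<rparr>"

definition laurent_const :: "('a, 'm) ring_scheme \<Rightarrow> 'a \<Rightarrow> int \<Rightarrow> 'a" where
  "laurent_const R a = (\<lambda>n. if n = 0 then a else \<zero>\<^bsub>R\<^esub>)"

definition laurent_u :: "('a, 'm) ring_scheme \<Rightarrow> int \<Rightarrow> 'a" where
  "laurent_u R = (\<lambda>n. if n = -1 then \<one>\<^bsub>R\<^esub> else \<zero>\<^bsub>R\<^esub>)"

text \<open>The expansions of \<open>1 / (u - a)\<close> and, when \<open>2\<close> is invertible, of \<open>1 / (2 u - a)\<close>.\<close>

definition recip_u_minus :: "('a, 'm) ring_scheme \<Rightarrow> 'a \<Rightarrow> int \<Rightarrow> 'a" where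
  "recip_u_minus R a = (\<lambda>l. if l \<ge> 1 then a [^]\<^bsub>R\<^esub> nat (l - 1) else \<zero>\<^bsub>R\<^esub>)"

definition recip_2u_minus :: "('a, 'm) ring_scheme \<Rightarrow> 'a \<Rightarrow> int \<Rightarrow> 'a" where
  "recip_2u_minus R a =
    (\<lambda>l. if l \<ge> 1
         then (inv\<^bsub>R\<^esub> ([(2::nat)] \<cdot>\<^bsub>R\<^esub> \<one>\<^bsub>R\<^esub>)) [^]\<^bsub>R\<^esub> nat l \<otimes>\<^bsub>R\<^esub> a [^]\<^bsub>R\<^esub> nat (l - 1) else \<zero>\<^bsub>R\<^esub>)"

end

theory Submission
  imports Defs
begin

text \<open>
  Write \<open>v = u - y\<^sub>i\<close>, \<open>v' = u - y\<^sub>i\<^sub>+\<^sub>1\<close>, with inverses \<open>U\<close>, \<open>U'\<close>. The relation defining \<open>e\<close> becomes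
  \<open>e = 1 + v' t - t v\<close>; multiplied by \<open>U'\<close> on the left and \<open>U\<close> on the right it yields
  \<open>U' t = t U + U' U - U' e U\<close>, and conjugated by \<open>t\<close> first, it yields \<open>U t = t U' - U U' + U e U'\<close>.
  The series \<open>D = 1 / (v + v')\<close> commutes with \<open>t\<close>, \<open>e\<close>, \<open>U\<close>, \<open>U'\<close> and satisfies \<open>D (U + U') = U U'\<close>.
  Both identities are formal consequences of these three equations and of \<open>t\<^sup>2 = 1\<close>, \<open>e t = t e = \<epsilon> e\<close>.
\<close>

section \<open>Free algebras and presentations\<close>

text \<open>The denominator \<open>2 u - (y\<^sub>i + y\<^sub>i\<^sub>+\<^sub>1)\<close> is exactly
  \<open>v + v'\<close>. Hence all three reciprocals are two-sided inverses inside one ring, and the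
  identities can be checked in an arbitrary ring without comparing coefficients; expansions in
  \<open>u\<^sup>-\<^sup>1\<close> matter only for showing that the given series are these inverses.
  The series \<open>D\<close> can be moved around because
  \<open>y\<^sub>i + y\<^sub>i\<^sub>+\<^sub>1\<close> commutes with \<open>t\<close> by a defining
  relation, with both \<open>y\<close>'s since these commute, and therefore with \<open>e\<close>,
  which is a polynomial in these elements. Commutation with an element passes to its inverse. The
  equation \<open>t\<^sup>2 = 1\<close> is the delicate input: the presentation directly gives only
  that \<open>t\<^sup>2\<close> is the generator attached to the identity permutation, an idempotent
  that fixes \<open>t\<close> on both sides. The BMW relation \<open>e t = \<epsilon> e\<close>,
  combined with the formula for \<open>e\<close>, forces this idempotent to be \<open>1\<close>, so
  the argument takes place in the BMW quotient. Coefficients never commute in general, so the ring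
  axioms for the free algebra and for Laurent series are obtained by reordering finite sums.\<close>

lemma (in abelian_monoid) finsum_swap:
  assumes "finite A" "finite B" "\<And>a b. a \<in> A \<Longrightarrow> b \<in> B \<Longrightarrow> f a b \<in> carrier G"
  shows "(\<Oplus>a\<in>A. \<Oplus>b\<in>B. f a b) = (\<Oplus>b\<in>B. \<Oplus>a\<in>A. f a b)"
  using assms(1,3)
proof (induction A rule: finite_induct)
  case (insert x A)
  then have "(\<Oplus>a\<in>insert x A. \<Oplus>b\<in>B. f a b) = (\<Oplus>b\<in>B. f x b \<oplus> (\<Oplus>a\<in>A. f a b))"
    by (simp add: finsum_addf Pi_def)
  also have "\<dots> = (\<Oplus>b\<in>B. \<Oplus>a\<in>insert x A. f a b)"
    using insert by (intro finsum_cong') (auto simp: Pi_def)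
  finally show ?case .
qed (simp add: finsum_zero)

text \<open>Both sides run over the triangle \<open>m \<le> n \<le> N\<close>, with
  \<open>n = m + j\<close> on the right. Padding with zeros to a square reduces the exchange to
  \<open>finsum_swap\<close>.\<close>

lemma (in abelian_monoid) finsum_triangle_swap:
  assumes f: "\<And>m n. f m n \<in> carrier G"
  shows "(\<Oplus>n\<in>{..N::nat}. \<Oplus>m\<in>{..n}. f m n) = (\<Oplus>m\<in>{..N}. \<Oplus>j\<in>{..N - m}. f m (m + j))"
proof -
  have "(\<Oplus>n\<in>{..N}. \<Oplus>m\<in>{..n}. f m n) = (\<Oplus>n\<in>{..N}. \<Oplus>m\<in>{..N}. if m \<le> n then f m n else \<zero>)"
    using f by (intro finsum_cong' refl add.finprod_mono_neutral_cong_left) (auto simp: Pi_def)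
  also have "\<dots> = (\<Oplus>m\<in>{..N}. \<Oplus>n\<in>{..N}. if m \<le> n then f m n else \<zero>)"
    using f by (intro finsum_swap) auto
  also have "\<dots> = (\<Oplus>m\<in>{..N}. \<Oplus>j\<in>{..N - m}. f m (m + j))"
  proof (rule finsum_cong'[OF refl])
    fix m assume "m \<in> {..N}"
    then have im: "(+) m ` {..N - m} = {m..N}"
      by (simp add: image_add_atMost atMost_atLeast0)
    have "(\<Oplus>n\<in>{..N}. if m \<le> n then f m n else \<zero>) = (\<Oplus>n\<in>(+) m ` {..N - m}. f m n)"
      using f unfolding im by (intro add.finprod_mono_neutral_cong_right) (auto simp: Pi_def)
    then show "(\<Oplus>n\<in>{..N}. if m \<le> n then f m n else \<zero>) = (\<Oplus>j\<in>{..N - m}. f m (m + j))"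
      using f by (simp add: add.finprod_reindex)
  qed (use f in auto)
  finally show ?thesis .
qed

section \<open>The free algebra is a ring\<close>

context ring begin

lemma free_algebra_sel:
  "p \<otimes>\<^bsub>free_algebra R S\<^esub> q = (\<lambda>w. \<Oplus>n\<in>{..length w}. p (take n w) \<otimes> q (drop n w))"
  "\<one>\<^bsub>free_algebra R S\<^esub> = (\<lambda>w. if w = [] then \<one> else \<zero>)"
  "\<zero>\<^bsub>free_algebra R S\<^esub> = (\<lambda>w. \<zero>)"
  "p \<oplus>\<^bsub>free_algebra R S\<^esub> q = (\<lambda>w. p w \<oplus> q w)"
  by (simp_all add: free_algebra_def)

lemma free_algebra_carrier:
  "p \<in> carrier (free_algebra R S) \<longleftrightarrow>
    (\<forall>w. p w \<in> carrier R) \<and> finite {w. p w \<noteq> \<zero>} \<and> {w. p w \<noteq> \<zero>} \<subseteq> lists S"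
  by (simp add: free_algebra_def)

text \<open>A nonzero coefficient at \<open>w\<close> needs a cut of \<open>w\<close> into a word of
  the support of \<open>p\<close> and one of the support of \<open>q\<close>. The support of the
  product thus lies in the finite set of concatenations of such words.\<close>

lemma free_algebra_mult_closed:
  assumes p: "p \<in> carrier (free_algebra R S)" and q: "q \<in> carrier (free_algebra R S)"
  shows "p \<otimes>\<^bsub>free_algebra R S\<^esub> q \<in> carrier (free_algebra R S)"
proof -
  let ?P = "{w. p w \<noteq> \<zero>}" and ?Q = "{w. q w \<noteq> \<zero>}"
  let ?pq = "p \<otimes>\<^bsub>free_algebra R S\<^esub> q"
  have c [simp]: "p w \<in> carrier R" "q w \<in> carrier R" for w
    using p q by (auto simp: free_algebra_carrier)
  have sub: "{w. ?pq w \<noteq> \<zero>} \<subseteq> (\<lambda>(a, b). a @ b) ` (?P \<times> ?Q)"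
  proof
    fix w assume "w \<in> {w. ?pq w \<noteq> \<zero>}"
    then have "(\<Oplus>n\<in>{..length w}. p (take n w) \<otimes> q (drop n w)) \<noteq> \<zero>"
      by (simp add: free_algebra_sel)
    then obtain n where "p (take n w) \<otimes> q (drop n w) \<noteq> \<zero>"
      using add.finprod_one_eqI by (metis (no_types, lifting))
    then have "take n w \<in> ?P" "drop n w \<in> ?Q" by auto
    then have "(\<lambda>(a, b). a @ b) (take n w, drop n w) \<in> (\<lambda>(a, b). a @ b) ` (?P \<times> ?Q)"
      by (intro imageI) simp
    then show "w \<in> (\<lambda>(a, b). a @ b) ` (?P \<times> ?Q)" by simp
  qed
  moreover have "finite ((\<lambda>(a, b). a @ b) ` (?P \<times> ?Q))"
    using p q by (auto simp: free_algebra_carrier)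
  moreover have "(\<lambda>(a, b). a @ b) ` (?P \<times> ?Q) \<subseteq> lists S"
  proof -
    have "?P \<subseteq> lists S" "?Q \<subseteq> lists S"
      using p q by (auto simp only: free_algebra_carrier)
    then show ?thesis by (auto simp: in_lists_conv_set subset_iff)
  qed
  moreover have "?pq w \<in> carrier R" for w
    by (simp add: free_algebra_sel finsum_closed)
  ultimately show ?thesis
    unfolding free_algebra_carrier by (meson finite_subset subset_trans)
qed

lemma free_algebra_add_closed:
  assumes p: "p \<in> carrier (free_algebra R S)" and q: "q \<in> carrier (free_algebra R S)"
  shows "p \<oplus>\<^bsub>free_algebra R S\<^esub> q \<in> carrier (free_algebra R S)"
proof -
  have "{w. p w \<oplus> q w \<noteq> \<zero>} \<subseteq> {w. p w \<noteq> \<zero>} \<union> {w. q w \<noteq> \<zero>}"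
    by auto
  moreover have "finite ({w. p w \<noteq> \<zero>} \<union> {w. q w \<noteq> \<zero>})" "{w. p w \<noteq> \<zero>} \<union> {w. q w \<noteq> \<zero>} \<subseteq> lists S"
    using p q by (auto simp only: free_algebra_carrier)
  ultimately have "finite {w. p w \<oplus> q w \<noteq> \<zero>}" "{w. p w \<oplus> q w \<noteq> \<zero>} \<subseteq> lists S"
    by (meson finite_subset subset_trans)+
  then show ?thesis
    using p q by (simp only: free_algebra_carrier free_algebra_sel) simp
qed

text \<open>At \<open>w\<close> both sides sum over the ways of cutting \<open>w\<close> into three
  pieces. One bracketing chooses the later cut \<open>n\<close> first, the other the earlier cut
  \<open>m\<close> and then the length \<open>j\<close> of the middle piece, so the triangle
  exchange applies.\<close>

lemma free_algebra_assoc: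
  assumes [simp]: "\<And>w. p w \<in> carrier R" "\<And>w. q w \<in> carrier R" "\<And>w. r w \<in> carrier R"
  shows "p \<otimes>\<^bsub>free_algebra R S\<^esub> q \<otimes>\<^bsub>free_algebra R S\<^esub> r
    = p \<otimes>\<^bsub>free_algebra R S\<^esub> (q \<otimes>\<^bsub>free_algebra R S\<^esub> r)"
proof
  fix w
  let ?f = "\<lambda>m n. p (take m w) \<otimes> q (drop m (take n w)) \<otimes> r (drop n w)"
  have "(p \<otimes>\<^bsub>free_algebra R S\<^esub> q \<otimes>\<^bsub>free_algebra R S\<^esub> r) w
      = (\<Oplus>n\<in>{..length w}. \<Oplus>m\<in>{..n}. ?f m n)"
    unfolding free_algebra_sel
    by (intro finsum_cong'[OF refl]) (auto simp: finsum_ldistr min_def intro!: finsum_cong')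
  also have "\<dots> = (\<Oplus>m\<in>{..length w}. \<Oplus>j\<in>{..length w - m}. ?f m (m + j))"
    by (rule finsum_triangle_swap) simp
  also have "\<dots> = (p \<otimes>\<^bsub>free_algebra R S\<^esub> (q \<otimes>\<^bsub>free_algebra R S\<^esub> r)) w"
    unfolding free_algebra_sel
    by (intro finsum_cong'[OF refl])
      (auto simp: finsum_rdistr m_assoc drop_take add.commute intro!: finsum_cong')
  finally show "(p \<otimes>\<^bsub>free_algebra R S\<^esub> q \<otimes>\<^bsub>free_algebra R S\<^esub> r) w
      = (p \<otimes>\<^bsub>free_algebra R S\<^esub> (q \<otimes>\<^bsub>free_algebra R S\<^esub> r)) w" .
qed

lemma free_scalar_mult:
  assumes [simp]: "a \<in> carrier R" "\<And>w. p w \<in> carrier R"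
  shows "free_scalar R a \<otimes>\<^bsub>free_algebra R S\<^esub> p = (\<lambda>w. a \<otimes> p w)"
    and "p \<otimes>\<^bsub>free_algebra R S\<^esub> free_scalar R a = (\<lambda>w. p w \<otimes> a)"
proof -
  show "free_scalar R a \<otimes>\<^bsub>free_algebra R S\<^esub> p = (\<lambda>w. a \<otimes> p w)"
  proof
    fix w
    have "(free_scalar R a \<otimes>\<^bsub>free_algebra R S\<^esub> p) w
        = (\<Oplus>n\<in>{..length w}. if 0 = n then a \<otimes> p (drop n w) else \<zero>)"
      unfolding free_algebra_sel free_scalar_def by (intro finsum_cong') auto
    also have "\<dots> = a \<otimes> p (drop 0 w)"
      by (rule add.finprod_singleton) auto
    finally show "(free_scalar R a \<otimes>\<^bsub>free_algebra R S\<^esub> p) w = a \<otimes> p w" by simp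
  qed
  show "p \<otimes>\<^bsub>free_algebra R S\<^esub> free_scalar R a = (\<lambda>w. p w \<otimes> a)"
  proof
    fix w
    have "(p \<otimes>\<^bsub>free_algebra R S\<^esub> free_scalar R a) w
        = (\<Oplus>n\<in>{..length w}. if length w = n then p (take n w) \<otimes> a else \<zero>)"
      unfolding free_algebra_sel free_scalar_def by (intro finsum_cong') auto
    also have "\<dots> = p (take (length w) w) \<otimes> a"
      by (rule add.finprod_singleton) auto
    finally show "(p \<otimes>\<^bsub>free_algebra R S\<^esub> free_scalar R a) w = p w \<otimes> a" by simp
  qed
qed

lemma free_scalar_one: "\<one>\<^bsub>free_algebra R S\<^esub> = free_scalar R \<one>"
  by (simp add: free_algebra_sel free_scalar_def)

lemma free_scalar_closed: "a \<in> carrier R \<Longrightarrow> free_scalar R a \<in> carrier (free_algebra R S)"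
proof -
  have "{w. free_scalar R a w \<noteq> \<zero>} \<subseteq> {[]}"
    by (auto simp: free_scalar_def)
  then show "a \<in> carrier R \<Longrightarrow> ?thesis"
    by (auto simp: free_algebra_carrier free_scalar_def)
qed

lemma free_gen_closed: "g \<in> S \<Longrightarrow> free_gen R g \<in> carrier (free_algebra R S)"
  by (auto simp: free_algebra_carrier free_gen_def)

lemma free_algebra_is_ring: "ring (free_algebra R S)"
proof (rule ringI)
  let ?F = "free_algebra R S"
  have c: "p w \<in> carrier R" if "p \<in> carrier ?F" for p w
    using that by (simp add: free_algebra_carrier)
  show "abelian_group ?F"
  proof (rule abelian_groupI)
    fix p assume p: "p \<in> carrier ?F"
    have "{w. \<ominus> p w \<noteq> \<zero>} = {w. p w \<noteq> \<zero>}"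
      using c[OF p] by (metis minus_minus minus_zero)
    then have "(\<lambda>w. \<ominus> p w) \<in> carrier ?F"
      using p by (simp only: free_algebra_carrier) simp
    moreover have "(\<lambda>w. \<ominus> p w) \<oplus>\<^bsub>?F\<^esub> p = \<zero>\<^bsub>?F\<^esub>"
      using c[OF p] by (simp add: free_algebra_sel l_neg)
    ultimately show "\<exists>q\<in>carrier ?F. q \<oplus>\<^bsub>?F\<^esub> p = \<zero>\<^bsub>?F\<^esub>" by blast
  qed (auto simp: free_algebra_add_closed, auto simp: free_algebra_sel c a_ac, simp add: free_algebra_carrier)
  show "monoid ?F"
  proof (rule monoidI)
    fix p assume "p \<in> carrier ?F"
    then show "\<one>\<^bsub>?F\<^esub> \<otimes>\<^bsub>?F\<^esub> p = p" "p \<otimes>\<^bsub>?F\<^esub> \<one>\<^bsub>?F\<^esub> = p"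
      by (simp_all add: free_scalar_one free_scalar_mult c)
  qed (simp_all add: free_algebra_mult_closed free_algebra_assoc c free_scalar_one free_scalar_closed)
  fix p q r assume "p \<in> carrier ?F" "q \<in> carrier ?F" "r \<in> carrier ?F"
  then show "(p \<oplus>\<^bsub>?F\<^esub> q) \<otimes>\<^bsub>?F\<^esub> r = p \<otimes>\<^bsub>?F\<^esub> r \<oplus>\<^bsub>?F\<^esub> q \<otimes>\<^bsub>?F\<^esub> r"
      "r \<otimes>\<^bsub>?F\<^esub> (p \<oplus>\<^bsub>?F\<^esub> q) = r \<otimes>\<^bsub>?F\<^esub> p \<oplus>\<^bsub>?F\<^esub> r \<otimes>\<^bsub>?F\<^esub> q"
    by (auto simp: free_algebra_sel l_distr r_distr c finsum_addf)
qed

text \<open>Followed by the two quotient maps, this homomorphism carries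
  \<open>\<epsilon> = 1\<close> or \<open>\<epsilon> = - 1\<close> and the invertibility of
  \<open>2\<close> from the base ring to the BMW algebra.\<close>

lemma free_scalar_hom: "free_scalar R \<in> ring_hom R (free_algebra R S)"
proof (rule ring_hom_memI)
  fix a b assume ab: "a \<in> carrier R" "b \<in> carrier R"
  have "free_scalar R b w \<in> carrier R" for w
    using ab by (simp add: free_scalar_def)
  note mult = free_scalar_mult(1)[OF ab(1) this]
  have "free_scalar R (a \<otimes> b) = (\<lambda>w. a \<otimes> free_scalar R b w)"
    using ab by (auto simp: free_scalar_def)
  also note mult[symmetric]
  finally show "free_scalar R (a \<otimes> b) = free_scalar R a \<otimes>\<^bsub>free_algebra R S\<^esub> free_scalar R b" .
  show "free_scalar R (a \<oplus> b) = free_scalar R a \<oplus>\<^bsub>free_algebra R S\<^esub> free_scalar R b"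
    using ab by (auto simp: free_scalar_def free_algebra_sel)
qed (simp_all add: free_scalar_closed free_scalar_one)

section \<open>Quotients by the two-sided ideal of a set of relations\<close>

context
  fixes rels :: "('a \<times> 'a) set"
  assumes rels: "rels \<subseteq> carrier R \<times> carrier R"
begin

lemma rel_ideal_is_ideal: "ideal (rel_ideal R rels) R"
  unfolding rel_ideal_def using rels by (intro genideal_ideal) auto

lemma rel_quot_is_ring: "ring (rel_quot R rels)"
  unfolding rel_quot_def by (rule ideal.quotient_is_ring[OF rel_ideal_is_ideal])

lemma rel_class_hom: "rel_class R rels \<in> ring_hom R (rel_quot R rels)"
  using ideal.rcos_ring_hom[OF rel_ideal_is_ideal]
  by (simp add: rel_quot_def rel_class_def[abs_def])

lemma rel_class_eq:
  assumes "(a, b) \<in> rels"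
  shows "rel_class R rels a = rel_class R rels b"
proof -
  have "a \<ominus> b \<in> (\<lambda>(a, b). a \<ominus> b) ` rels"
    by (rule rev_image_eqI[OF assms]) simp
  moreover have "(\<lambda>(a, b). a \<ominus> b) ` rels \<subseteq> carrier R"
    using rels by auto
  ultimately have "a \<ominus> b \<in> rel_ideal R rels"
    unfolding rel_ideal_def by (rule subsetD[OF genideal_self, rotated])
  moreover have "a \<in> carrier R" "b \<in> carrier R"
    using assms rels by auto
  ultimately show ?thesis
    unfolding rel_class_def by (simp add: quotient_eq_iff_same_a_r_cos[OF rel_ideal_is_ideal])
qed

end
end


section \<open>Identities in a noncommutative ring\<close>

context ring begin

text \<open>Insert \<open>w v = 1\<close> on the left and move \<open>x\<close> past
  \<open>v\<close>. This is the source of every commutation of \<open>D\<close>, \<open>U\<close>,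
  \<open>U'\<close> and of the scalar \<open>1 / 2\<close>.\<close>

lemma inverse_commutes:
  assumes [simp]: "x \<in> carrier R" "v \<in> carrier R" "w \<in> carrier R"
    and "v \<otimes> w = \<one>" "w \<otimes> v = \<one>" "x \<otimes> v = v \<otimes> x"
  shows "x \<otimes> w = w \<otimes> x"
proof -
  have "x \<otimes> w = (w \<otimes> v) \<otimes> (x \<otimes> w)"
    using assms by simp
  also have "\<dots> = w \<otimes> (v \<otimes> x) \<otimes> w"
    by (simp add: m_assoc)
  also have "\<dots> = w \<otimes> (x \<otimes> v) \<otimes> w"
    using assms by simp
  also have "\<dots> = w \<otimes> x \<otimes> (v \<otimes> w)"
    by (simp add: m_assoc)
  finally show ?thesis
    using assms by simp
qed

text \<open>The outer factors cancel \<open>v'\<close> on the left and \<open>v\<close> on the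
  right. The element \<open>s\<close> is kept general because the lemma serves twice: for
  \<open>s = t\<close>, and for \<open>s = - t\<close> with the roles of \<open>v\<close> and
  \<open>v'\<close> exchanged.\<close>

lemma twisted_commutation:
  assumes [simp]: "s \<in> carrier R" "v \<in> carrier R" "v' \<in> carrier R" "w \<in> carrier R" "w' \<in> carrier R"
    and "v \<otimes> w = \<one>" "w' \<otimes> v' = \<one>"
  shows "w' \<otimes> (\<one> \<oplus> v' \<otimes> s \<ominus> s \<otimes> v) \<otimes> w = w' \<otimes> w \<oplus> s \<otimes> w \<ominus> w' \<otimes> s"
proof -
  have "w' \<otimes> (\<one> \<oplus> v' \<otimes> s \<ominus> s \<otimes> v) \<otimes> w = w' \<otimes> w \<oplus> (w' \<otimes> v') \<otimes> s \<otimes> w \<ominus> w' \<otimes> s \<otimes> (v \<otimes> w)"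
    using assms(1-5) by algebra
  then show ?thesis
    using assms by simp
qed

text \<open>The right side of the first identity is \<open>D D - 1\<close> in disguise, because
  \<open>v + v'\<close> is inverse to \<open>D\<close>. In the second identity both sides reduce to
  the common form \<open>U' + t - e D - U U' t - D U' e U\<close>. Rearrangements valid in every
  ring alternate with explicit uses of the relations.\<close>

lemma BMW_series_identities:
  assumes [simp]: "t \<in> carrier R" "e \<in> carrier R" "v \<in> carrier R" "v' \<in> carrier R"
      "U \<in> carrier R" "U' \<in> carrier R" "D \<in> carrier R" "\<epsilon> \<in> carrier R"
    and \<epsilon>: "\<epsilon> \<in> {\<one>, \<ominus> \<one>}"
    and tt: "t \<otimes> t = \<one>" and et: "e \<otimes> t = \<epsilon> \<otimes> e" and te: "t \<otimes> e = \<epsilon> \<otimes> e"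
    and e: "e = \<one> \<oplus> v' \<otimes> t \<ominus> t \<otimes> v"
    and vv': "v \<otimes> v' = v' \<otimes> v" and t_sum: "t \<otimes> (v \<oplus> v') = (v \<oplus> v') \<otimes> t"
    and U: "v \<otimes> U = \<one>" "U \<otimes> v = \<one>" and U': "v' \<otimes> U' = \<one>" "U' \<otimes> v' = \<one>"
    and D: "(v \<oplus> v') \<otimes> D = \<one>" "D \<otimes> (v \<oplus> v') = \<one>"
  shows "(e \<otimes> U' \<ominus> t \<ominus> D) \<otimes> (e \<otimes> U \<oplus> t \<ominus> D)
         = (\<ominus> ((v \<oplus> v' \<oplus> \<one>) \<otimes> (v \<oplus> v' \<ominus> \<one>))) \<otimes> (D \<otimes> D)"
    and "(U' \<oplus> t \<ominus> e \<otimes> D) \<ominus> U \<otimes> (U' \<oplus> t \<ominus> e \<otimes> D) \<otimes> U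
         = (t \<otimes> U \<otimes> t \<oplus> t \<ominus> e \<otimes> D)
             \<ominus> U' \<otimes> (e \<otimes> U \<otimes> e \<oplus> \<epsilon> \<otimes> e \<ominus> e \<otimes> D) \<otimes> U'"
proof -
  define b where "b = v \<oplus> v'"
  have b [simp]: "b \<in> carrier R" by (simp add: b_def)
  have bt: "t \<otimes> b = b \<otimes> t" using t_sum by (simp add: b_def)
  have bv: "v \<otimes> b = b \<otimes> v" "v' \<otimes> b = b \<otimes> v'"
    using vv' by (simp_all add: b_def l_distr r_distr)
  \<comment> \<open>By its formula \<open>e\<close> is a polynomial in \<open>t\<close>,
    \<open>v\<close>, \<open>v'\<close>, and \<open>b\<close> can be carried past each of these in
    turn.\<close>
  have be: "e \<otimes> b = b \<otimes> e"
  proof -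
    have "e \<otimes> b = b \<oplus> v' \<otimes> (t \<otimes> b) \<ominus> t \<otimes> (v \<otimes> b)"
      unfolding e using assms(1-8) b by algebra
    also have "\<dots> = b \<oplus> v' \<otimes> (b \<otimes> t) \<ominus> t \<otimes> (b \<otimes> v)"
      by (simp only: bt bv(1))
    also have "\<dots> = b \<oplus> (v' \<otimes> b) \<otimes> t \<ominus> (t \<otimes> b) \<otimes> v"
      using assms(1-8) b by algebra
    also have "\<dots> = b \<oplus> (b \<otimes> v') \<otimes> t \<ominus> (b \<otimes> t) \<otimes> v"
      by (simp only: bt bv(2))
    also have "\<dots> = b \<otimes> e"
      unfolding e using assms(1-8) b r_one[OF b] by algebra
    finally show ?thesis .
  qed
  have bU: "U \<otimes> b = b \<otimes> U" "U' \<otimes> b = b \<otimes> U'"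
    using inverse_commutes[of b v U] inverse_commutes[of b v' U'] U U' bv by simp_all
  have Dt: "D \<otimes> t = t \<otimes> D" and De: "D \<otimes> e = e \<otimes> D"
    and DU: "D \<otimes> U = U \<otimes> D" and DU': "D \<otimes> U' = U' \<otimes> D"
    using inverse_commutes[of _ b D] D[folded b_def] bt be bU by simp_all
  have UU': "U \<otimes> U' = U' \<otimes> U"
  proof -
    have "v \<otimes> U' = U' \<otimes> v" by (rule inverse_commutes[of v v' U']) (use U' vv' in simp_all)
    then show ?thesis
      using inverse_commutes[of U' v U] U by simp
  qed
  \<comment> \<open>Partial fractions:
    \<open>b U' U = U' U b = U' (U v) + (U U') v' = U' + U\<close>, and then \<open>D\<close>
    cancels \<open>b\<close>.\<close>
  have DS: "D \<otimes> U \<oplus> D \<otimes> U' = U' \<otimes> U"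
  proof -
    have "b \<otimes> (U' \<otimes> U) = (U' \<otimes> U) \<otimes> b"
      using bU by (metis m_assoc assms(5,6) b)
    also have "\<dots> = U' \<otimes> (U \<otimes> v) \<oplus> (U \<otimes> U') \<otimes> v'"
      unfolding b_def UU' using assms(1-8) by algebra
    also have "\<dots> = U \<oplus> U'"
      using U U' by (simp add: m_assoc a_comm)
    finally have "D \<otimes> (U \<oplus> U') = (D \<otimes> b) \<otimes> (U' \<otimes> U)"
      by (metis m_assoc assms(5-7) b m_closed)
    then show ?thesis
      using D by (simp add: b_def r_distr)
  qed
  have tet: "t \<otimes> e \<otimes> t = e"
    using \<epsilon> te et by (auto simp: m_assoc l_minus r_minus)
  have \<epsilon>_central: "x \<otimes> \<epsilon> = \<epsilon> \<otimes> x" if "x \<in> carrier R" for x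
    using \<epsilon> that by (auto simp: l_minus r_minus)

  have U't: "U' \<otimes> t = t \<otimes> U \<oplus> U' \<otimes> U \<ominus> U' \<otimes> e \<otimes> U"
  proof -
    have "U' \<otimes> e \<otimes> U = U' \<otimes> U \<oplus> t \<otimes> U \<ominus> U' \<otimes> t"
      unfolding e by (rule twisted_commutation) (use U U' in simp_all)
    then have "t \<otimes> U \<oplus> U' \<otimes> U \<ominus> U' \<otimes> e \<otimes> U
        = t \<otimes> U \<oplus> U' \<otimes> U \<ominus> (U' \<otimes> U \<oplus> t \<otimes> U \<ominus> U' \<otimes> t)"
      by simp
    also have "\<dots> = U' \<otimes> t"
      using assms(1-8) by algebra
    finally show ?thesis by simp
  qed
  have Ut: "U \<otimes> t = t \<otimes> U' \<ominus> U \<otimes> U' \<oplus> U \<otimes> e \<otimes> U'"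
  proof -
    \<comment> \<open>Since \<epsilon> squares to one, \<open>t e t = e\<close>. Conjugating the
      formula for \<open>e\<close> therefore gives a second formula of the same shape, with
      \<open>v\<close> and \<open>v'\<close> exchanged and \<open>- t\<close> in place of
      \<open>t\<close>.\<close>
    have "e = t \<otimes> (\<one> \<oplus> v' \<otimes> t \<ominus> t \<otimes> v) \<otimes> t"
      using tet e by simp
    also have "\<dots> = t \<otimes> t \<oplus> t \<otimes> v' \<otimes> (t \<otimes> t) \<ominus> (t \<otimes> t) \<otimes> v \<otimes> t"
      using assms(1-8) by algebra
    also have "\<dots> = \<one> \<oplus> v \<otimes> (\<ominus> t) \<ominus> (\<ominus> t) \<otimes> v'"
      unfolding tt using assms(1-8) r_one[OF assms(4)] by algebra
    finally have "U \<otimes> e \<otimes> U' = U \<otimes> (\<one> \<oplus> v \<otimes> (\<ominus> t) \<ominus> (\<ominus> t) \<otimes> v') \<otimes> U'"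
      by simp
    also have "\<dots> = U \<otimes> U' \<oplus> (\<ominus> t) \<otimes> U' \<ominus> U \<otimes> (\<ominus> t)"
      by (rule twisted_commutation) (use U U' in simp_all)
    finally have "t \<otimes> U' \<ominus> U \<otimes> U' \<oplus> U \<otimes> e \<otimes> U'
        = t \<otimes> U' \<ominus> U \<otimes> U' \<oplus> (U \<otimes> U' \<oplus> (\<ominus> t) \<otimes> U' \<ominus> U \<otimes> (\<ominus> t))"
      by simp
    also have "\<dots> = U \<otimes> t"
      using assms(1-8) by algebra
    finally show ?thesis by simp
  qed

  have "(e \<otimes> U' \<ominus> t \<ominus> D) \<otimes> (e \<otimes> U \<oplus> t \<ominus> D)
      = e \<otimes> U' \<otimes> e \<otimes> U \<oplus> e \<otimes> (U' \<otimes> t) \<ominus> e \<otimes> (U' \<otimes> D) \<ominus> (t \<otimes> e) \<otimes> U \<ominus> t \<otimes> t \<oplus> t \<otimes> D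
        \<ominus> (D \<otimes> e) \<otimes> U \<ominus> D \<otimes> t \<oplus> D \<otimes> D"
    using assms(1-8) by algebra
  \<comment> \<open>Replacing \<open>U' t\<close> produces \<open>- e U' e U\<close>, which removes
    the quartic term, and \<open>e t U\<close>, which cancels against \<open>t e U\<close> because
    \<open>e t = t e\<close>. The two terms in \<open>t D\<close> cancel as well.\<close>
  also have "\<dots> = e \<otimes> U' \<otimes> e \<otimes> U \<oplus> e \<otimes> (t \<otimes> U \<oplus> U' \<otimes> U \<ominus> U' \<otimes> e \<otimes> U) \<ominus> e \<otimes> (D \<otimes> U')
        \<ominus> (e \<otimes> t) \<otimes> U \<ominus> \<one> \<oplus> t \<otimes> D \<ominus> (e \<otimes> D) \<otimes> U \<ominus> t \<otimes> D \<oplus> D \<otimes> D"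
    by (simp only: U't tt De Dt DU' et te)
  also have "\<dots> = e \<otimes> (U' \<otimes> U) \<ominus> e \<otimes> (D \<otimes> U \<oplus> D \<otimes> U') \<ominus> \<one> \<oplus> D \<otimes> D"
    using assms(1-8) by algebra
  also have "\<dots> = D \<otimes> D \<ominus> \<one>"
    unfolding DS using assms(1-8) by algebra
  \<comment> \<open>Here \<open>1\<close> is written as \<open>b (b D) D\<close>, using
    \<open>b D = 1\<close> twice, so that \<open>D D\<close> can be factored out on the
    right.\<close>
  also have "\<dots> = D \<otimes> D \<ominus> b \<otimes> (b \<otimes> D) \<otimes> D"
    using D by (simp add: b_def)
  also have "\<dots> = (\<ominus> ((b \<oplus> \<one>) \<otimes> (b \<ominus> \<one>))) \<otimes> (D \<otimes> D)"
    using assms(1-8) b by algebra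
  finally show "(e \<otimes> U' \<ominus> t \<ominus> D) \<otimes> (e \<otimes> U \<oplus> t \<ominus> D)
         = (\<ominus> ((v \<oplus> v' \<oplus> \<one>) \<otimes> (v \<oplus> v' \<ominus> \<one>))) \<otimes> (D \<otimes> D)"
    by (simp only: b_def)

  \<comment> \<open>This and the next fact produce the term in which the two sides of the second
    identity meet. Both come from \<open>DS\<close>, read once as \<open>U U' - U D = D U'\<close>
    to the left of \<open>e\<close>, and once as \<open>U U' - D U' = D U\<close> to its
    right.\<close>
  have UeU: "U \<otimes> (U' \<otimes> e) \<otimes> U \<ominus> U \<otimes> (D \<otimes> e) \<otimes> U = D \<otimes> U' \<otimes> e \<otimes> U"
    (is "?l = _")
  proof -
    have "?l = (U' \<otimes> U) \<otimes> e \<otimes> U \<ominus> (D \<otimes> U) \<otimes> e \<otimes> U"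
      unfolding UU'[symmetric] DU by (simp add: m_assoc)
    also have "\<dots> = D \<otimes> U' \<otimes> e \<otimes> U"
      unfolding DS[symmetric] using assms(1-8) by algebra
    finally show ?thesis .
  qed
  have U'eU': "U' \<otimes> e \<otimes> (U \<otimes> U') \<ominus> U' \<otimes> (e \<otimes> D) \<otimes> U' = D \<otimes> U' \<otimes> e \<otimes> U"
    (is "?l = _")
  proof -
    have "?l = U' \<otimes> e \<otimes> (D \<otimes> U \<oplus> D \<otimes> U') \<ominus> U' \<otimes> e \<otimes> (D \<otimes> U')"
      unfolding DS UU' by (simp add: m_assoc)
    also have "\<dots> = U' \<otimes> (e \<otimes> D) \<otimes> U"
      using assms(1-8) by algebra
    also have "\<dots> = (U' \<otimes> D) \<otimes> e \<otimes> U"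
      unfolding De[symmetric] by (simp add: m_assoc)
    finally show ?thesis by (simp only: DU')
  qed
  have "(U' \<oplus> t \<ominus> e \<otimes> D) \<ominus> U \<otimes> (U' \<oplus> t \<ominus> e \<otimes> D) \<otimes> U
      = U' \<oplus> t \<ominus> e \<otimes> D \<ominus> U \<otimes> (U' \<otimes> U) \<ominus> U \<otimes> (t \<otimes> U) \<oplus> U \<otimes> (e \<otimes> D) \<otimes> U"
    using assms(1-8) by algebra
  \<comment> \<open>This is substituted into \<open>U (t U)\<close> in the preceding expression; the
    resulting \<open>U U' U\<close> cancels the one already present.\<close>
  also have "t \<otimes> U = U' \<otimes> t \<ominus> U' \<otimes> U \<oplus> U' \<otimes> e \<otimes> U"
    unfolding U't using assms(1-8) by algebra
  also have "U' \<oplus> t \<ominus> e \<otimes> D \<ominus> U \<otimes> (U' \<otimes> U) \<ominus> U \<otimes> (U' \<otimes> t \<ominus> U' \<otimes> U \<oplus> U' \<otimes> e \<otimes> U)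
        \<oplus> U \<otimes> (e \<otimes> D) \<otimes> U
      = U' \<oplus> t \<ominus> e \<otimes> D \<ominus> U \<otimes> U' \<otimes> t \<ominus> (U \<otimes> (U' \<otimes> e) \<otimes> U \<ominus> U \<otimes> (e \<otimes> D) \<otimes> U)"
    using assms(1-8) by algebra
  also have "\<dots> = U' \<oplus> t \<ominus> e \<otimes> D \<ominus> U \<otimes> U' \<otimes> t \<ominus> D \<otimes> U' \<otimes> e \<otimes> U"
    using UeU by (simp only: De)
  finally have lhs: "(U' \<oplus> t \<ominus> e \<otimes> D) \<ominus> U \<otimes> (U' \<oplus> t \<ominus> e \<otimes> D) \<otimes> U
      = U' \<oplus> t \<ominus> e \<otimes> D \<ominus> U \<otimes> U' \<otimes> t \<ominus> D \<otimes> U' \<otimes> e \<otimes> U" .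

  \<comment> \<open>The commutation rules are applied from both ends: \<open>t U\<close> on the
    left, then the new factor \<open>U t\<close> behind \<open>e\<close>. This creates exactly the
    terms \<open>U' e U e U'\<close> and \<open>U' (\<epsilon> e) U'\<close> that the right side of
    the identity subtracts.\<close>
  have "t \<otimes> U \<otimes> t = (U' \<otimes> t \<ominus> U' \<otimes> U \<oplus> U' \<otimes> e \<otimes> U) \<otimes> t"
  proof -
    have "t \<otimes> U = U' \<otimes> t \<ominus> U' \<otimes> U \<oplus> U' \<otimes> e \<otimes> U"
      unfolding U't using assms(1-8) by algebra
    then show ?thesis by simp
  qed
  also have "\<dots> = U' \<otimes> (t \<otimes> t) \<ominus> U' \<otimes> U \<otimes> t \<oplus> U' \<otimes> e \<otimes> (U \<otimes> t)"
    using assms(1-8) by algebra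
  also have "\<dots> = U' \<ominus> U \<otimes> U' \<otimes> t \<oplus> U' \<otimes> e \<otimes> (t \<otimes> U' \<ominus> U \<otimes> U' \<oplus> U \<otimes> e \<otimes> U')"
    unfolding tt Ut UU' by simp
  also have "\<dots> = U' \<ominus> U \<otimes> U' \<otimes> t \<oplus> U' \<otimes> (e \<otimes> t) \<otimes> U' \<ominus> U' \<otimes> e \<otimes> (U \<otimes> U')
      \<oplus> U' \<otimes> e \<otimes> U \<otimes> e \<otimes> U'"
    using assms(1-8) by algebra
  finally have tUt: "t \<otimes> U \<otimes> t = U' \<ominus> U \<otimes> U' \<otimes> t \<oplus> U' \<otimes> (\<epsilon> \<otimes> e) \<otimes> U' \<ominus> U' \<otimes> e \<otimes> (U \<otimes> U')
      \<oplus> U' \<otimes> e \<otimes> U \<otimes> e \<otimes> U'"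
    by (simp only: et)
  have "(t \<otimes> U \<otimes> t \<oplus> t \<ominus> e \<otimes> D) \<ominus> U' \<otimes> (e \<otimes> U \<otimes> e \<oplus> \<epsilon> \<otimes> e \<ominus> e \<otimes> D) \<otimes> U'
     = U' \<oplus> t \<ominus> e \<otimes> D \<ominus> U \<otimes> U' \<otimes> t \<ominus> (U' \<otimes> e \<otimes> (U \<otimes> U') \<ominus> U' \<otimes> (e \<otimes> D) \<otimes> U')"
    unfolding tUt using assms(1-8) by algebra
  also have "\<dots> = U' \<oplus> t \<ominus> e \<otimes> D \<ominus> U \<otimes> U' \<otimes> t \<ominus> D \<otimes> U' \<otimes> e \<otimes> U"
    by (simp only: U'eU')
  finally show "(U' \<oplus> t \<ominus> e \<otimes> D) \<ominus> U \<otimes> (U' \<oplus> t \<ominus> e \<otimes> D) \<otimes> U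
         = (t \<otimes> U \<otimes> t \<oplus> t \<ominus> e \<otimes> D)
             \<ominus> U' \<otimes> (e \<otimes> U \<otimes> e \<oplus> \<epsilon> \<otimes> e \<ominus> e \<otimes> D) \<otimes> U'"
    by (simp only: lhs)
qed


section \<open>Laurent series\<close>

text \<open>Membership in the carrier only asserts that some bound exists. With the bound explicit,
  the index range of a product coefficient can be written down in advance.\<close>

definition lsupp_ge :: "int \<Rightarrow> (int \<Rightarrow> 'a) \<Rightarrow> bool" where
  "lsupp_ge N f \<longleftrightarrow> (\<forall>n. f n \<in> carrier R) \<and> (\<forall>n<N. f n = \<zero>)"

lemma laurent_carrier_iff: "f \<in> carrier (laurent_ring R) \<longleftrightarrow> (\<exists>N. lsupp_ge N f)"
  by (auto simp: laurent_ring_def lsupp_ge_def)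

text \<open>Outside \<open>{F..n - G}\<close> one factor of each summand vanishes. The index set
  \<open>A\<close> is left free so that different products can be expanded over one common set,
  which the defining sum over a joint support does not allow.\<close>

lemma laurent_mult:
  assumes f: "lsupp_ge F f" and g: "lsupp_ge G g"
    and A: "finite A" "{F..n - G} \<subseteq> A"
  shows "(f \<otimes>\<^bsub>laurent_ring R\<^esub> g) n = (\<Oplus>m\<in>A. f m \<otimes> g (n - m))"
proof -
  have "{m. f m \<noteq> \<zero> \<and> g (n - m) \<noteq> \<zero>} \<subseteq> {F..n - G}"
  proof
    fix m assume "m \<in> {m. f m \<noteq> \<zero> \<and> g (n - m) \<noteq> \<zero>}"
    then have "\<not> m < F" "\<not> n - m < G" using f g by (auto simp: lsupp_ge_def)
    then show "m \<in> {F..n - G}" by simp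
  qed
  with A have sub: "{m. f m \<noteq> \<zero> \<and> g (n - m) \<noteq> \<zero>} \<subseteq> A"
    by blast
  have "(f \<otimes>\<^bsub>laurent_ring R\<^esub> g) n = (\<Oplus>m\<in>{m. f m \<noteq> \<zero> \<and> g (n - m) \<noteq> \<zero>}. f m \<otimes> g (n - m))"
    by (simp add: laurent_ring_def)
  also have "\<dots> = (\<Oplus>m\<in>A. f m \<otimes> g (n - m))"
    using f g A(1) sub
    by (intro add.finprod_mono_neutral_cong_left) (auto simp: lsupp_ge_def)
  finally show ?thesis .
qed

lemma laurent_mult_supp:
  assumes f: "lsupp_ge F f" and g: "lsupp_ge G g"
  shows "lsupp_ge (F + G) (f \<otimes>\<^bsub>laurent_ring R\<^esub> g)"
  unfolding lsupp_ge_def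
proof (intro conjI allI impI)
  show "(f \<otimes>\<^bsub>laurent_ring R\<^esub> g) n \<in> carrier R" for n
    unfolding laurent_mult[OF f g finite_atLeastAtMost_int order_refl]
    using f g by (intro finsum_closed) (auto simp: lsupp_ge_def)
  show "(f \<otimes>\<^bsub>laurent_ring R\<^esub> g) n = \<zero>" if "n < F + G" for n
    unfolding laurent_mult[OF f g finite_atLeastAtMost_int order_refl] using that by simp
qed

lemma laurent_mult_assoc:
  assumes f: "lsupp_ge F f" and g: "lsupp_ge G g" and h: "lsupp_ge H h"
  shows "f \<otimes>\<^bsub>laurent_ring R\<^esub> g \<otimes>\<^bsub>laurent_ring R\<^esub> h
    = f \<otimes>\<^bsub>laurent_ring R\<^esub> (g \<otimes>\<^bsub>laurent_ring R\<^esub> h)"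
proof
  fix n
  let ?L = "laurent_ring R"
  \<comment> \<open>\<open>m\<close> is the total degree taken from \<open>f\<close> and
    \<open>g\<close>, and \<open>l\<close> the degree from \<open>f\<close>. Each range uses only
    the bounds \<open>F\<close>, \<open>G\<close>, \<open>H\<close> and \<open>n\<close>, not the
    other index, so the double sum is over a rectangle; the right bracketing reappears through
    \<open>j = m - l\<close>.\<close>
  let ?A = "{F + G..n - H}" and ?B = "{F..n - G - H}"
  have c [simp]: "f m \<in> carrier R" "g m \<in> carrier R" "h m \<in> carrier R" for m
    using f g h by (auto simp: lsupp_ge_def)
  have "(f \<otimes>\<^bsub>?L\<^esub> g \<otimes>\<^bsub>?L\<^esub> h) n = (\<Oplus>m\<in>?A. (f \<otimes>\<^bsub>?L\<^esub> g) m \<otimes> h (n - m))"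
    by (rule laurent_mult[OF laurent_mult_supp[OF f g] h]) simp_all
  also have "\<dots> = (\<Oplus>m\<in>?A. \<Oplus>l\<in>?B. f l \<otimes> g (m - l) \<otimes> h (n - m))"
  proof (rule finsum_cong'[OF refl])
    show "(\<lambda>m. \<Oplus>l\<in>?B. f l \<otimes> g (m - l) \<otimes> h (n - m)) \<in> ?A \<rightarrow> carrier R"
      by (auto intro!: finsum_closed)
    fix m assume "m \<in> ?A"
    then have "(f \<otimes>\<^bsub>?L\<^esub> g) m = (\<Oplus>l\<in>?B. f l \<otimes> g (m - l))"
      by (intro laurent_mult[OF f g]) auto
    then show "(f \<otimes>\<^bsub>?L\<^esub> g) m \<otimes> h (n - m) = (\<Oplus>l\<in>?B. f l \<otimes> g (m - l) \<otimes> h (n - m))"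
      by (simp add: finsum_ldistr)
  qed
  also have "\<dots> = (\<Oplus>l\<in>?B. \<Oplus>m\<in>?A. f l \<otimes> g (m - l) \<otimes> h (n - m))"
    by (rule finsum_swap) simp_all
  also have "\<dots> = (\<Oplus>l\<in>?B. f l \<otimes> (g \<otimes>\<^bsub>?L\<^esub> h) (n - l))"
  proof (rule finsum_cong'[OF refl])
    have "(g \<otimes>\<^bsub>?L\<^esub> h) m \<in> carrier R" for m
      using laurent_mult_supp[OF g h] by (auto simp: lsupp_ge_def)
    then show "(\<lambda>l. f l \<otimes> (g \<otimes>\<^bsub>?L\<^esub> h) (n - l)) \<in> ?B \<rightarrow> carrier R"
      by simp
    fix l assume l: "l \<in> ?B"
    have "(g \<otimes>\<^bsub>?L\<^esub> h) (n - l) = (\<Oplus>j\<in>(\<lambda>m. m - l) ` ?A. g j \<otimes> h (n - l - j))"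
    proof (rule laurent_mult[OF g h])
      show "{G..n - l - H} \<subseteq> (\<lambda>m. m - l) ` ?A"
      proof
        fix j assume "j \<in> {G..n - l - H}"
        then have "j = (j + l) - l" "j + l \<in> ?A" using l by auto
        then show "j \<in> (\<lambda>m. m - l) ` ?A" by blast
      qed
    qed simp
    also have "\<dots> = (\<Oplus>m\<in>?A. g (m - l) \<otimes> h (n - m))"
      by (subst add.finprod_reindex) (auto simp: inj_on_def algebra_simps)
    finally show "(\<Oplus>m\<in>?A. f l \<otimes> g (m - l) \<otimes> h (n - m)) = f l \<otimes> (g \<otimes>\<^bsub>?L\<^esub> h) (n - l)"
      by (simp add: finsum_rdistr m_assoc)
  qed
  also have "\<dots> = (f \<otimes>\<^bsub>?L\<^esub> (g \<otimes>\<^bsub>?L\<^esub> h)) n"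
    by (rule laurent_mult[OF f laurent_mult_supp[OF g h], symmetric]) auto
  finally show "(f \<otimes>\<^bsub>?L\<^esub> g \<otimes>\<^bsub>?L\<^esub> h) n = (f \<otimes>\<^bsub>?L\<^esub> (g \<otimes>\<^bsub>?L\<^esub> h)) n" .
qed

text \<open>The monomial is \<open>a u\<^sup>-\<^sup>k\<close>. Taking \<open>k = 0\<close> covers
  the unit and the constants, and \<open>k = - 1\<close> covers \<open>u\<close> and
  \<open>2 u\<close>.\<close>

lemma laurent_monom_mult:
  assumes a: "a \<in> carrier R" and f: "f \<in> carrier (laurent_ring R)"
  shows "(\<lambda>m. if m = k then a else \<zero>) \<otimes>\<^bsub>laurent_ring R\<^esub> f = (\<lambda>n. a \<otimes> f (n - k))"
    and "f \<otimes>\<^bsub>laurent_ring R\<^esub> (\<lambda>m. if m = k then a else \<zero>) = (\<lambda>n. f (n - k) \<otimes> a)"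
proof -
  let ?x = "\<lambda>m. if m = k then a else \<zero>"
  obtain F where f: "lsupp_ge F f" using f laurent_carrier_iff by blast
  then have c: "f n \<in> carrier R" for n by (simp add: lsupp_ge_def)
  have x: "lsupp_ge k ?x" using a by (simp add: lsupp_ge_def)
  show "?x \<otimes>\<^bsub>laurent_ring R\<^esub> f = (\<lambda>n. a \<otimes> f (n - k))"
  proof
    fix n
    \<comment> \<open>The interval may be empty; inserting \<open>k\<close> guarantees that the only
      contributing index is present.\<close>
    let ?A = "insert k {k..n - F}"
    have "(?x \<otimes>\<^bsub>laurent_ring R\<^esub> f) n = (\<Oplus>m\<in>?A. ?x m \<otimes> f (n - m))"
      by (rule laurent_mult[OF x f]) auto
    also have "\<dots> = (\<Oplus>m\<in>?A. if k = m then a \<otimes> f (n - m) else \<zero>)"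
      using a c by (intro add.finprod_cong') auto
    also have "\<dots> = a \<otimes> f (n - k)"
      using a c by (intro add.finprod_singleton) auto
    finally show "(?x \<otimes>\<^bsub>laurent_ring R\<^esub> f) n = a \<otimes> f (n - k)" .
  qed
  show "f \<otimes>\<^bsub>laurent_ring R\<^esub> ?x = (\<lambda>n. f (n - k) \<otimes> a)"
  proof
    fix n
    let ?A = "insert (n - k) {F..n - k}"
    have "(f \<otimes>\<^bsub>laurent_ring R\<^esub> ?x) n = (\<Oplus>m\<in>?A. f m \<otimes> ?x (n - m))"
      by (rule laurent_mult[OF f x]) auto
    also have "\<dots> = (\<Oplus>m\<in>?A. if n - k = m then f m \<otimes> a else \<zero>)"
      using a c by (intro add.finprod_cong') auto
    also have "\<dots> = f (n - k) \<otimes> a"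
      using a c by (intro add.finprod_singleton) auto
    finally show "(f \<otimes>\<^bsub>laurent_ring R\<^esub> ?x) n = f (n - k) \<otimes> a" .
  qed
qed

lemma laurent_ring_sel:
  "\<one>\<^bsub>laurent_ring R\<^esub> = (\<lambda>n. if n = 0 then \<one> else \<zero>)"
  "\<zero>\<^bsub>laurent_ring R\<^esub> = (\<lambda>n. \<zero>)"
  "f \<oplus>\<^bsub>laurent_ring R\<^esub> g = (\<lambda>n. f n \<oplus> g n)"
  by (simp_all add: laurent_ring_def)

lemma laurent_carrier_nth: "f \<in> carrier (laurent_ring R) \<Longrightarrow> f n \<in> carrier R"
  by (simp add: laurent_ring_def)

lemma laurent_add_supp:
  assumes "lsupp_ge F f" "lsupp_ge G g"
  shows "lsupp_ge (min F G) (f \<oplus>\<^bsub>laurent_ring R\<^esub> g)"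
  using assms by (auto simp: lsupp_ge_def laurent_ring_sel)

lemma laurent_distr:
  assumes f: "lsupp_ge F f" and g: "lsupp_ge G g" and h: "lsupp_ge H h"
  shows "(f \<oplus>\<^bsub>laurent_ring R\<^esub> g) \<otimes>\<^bsub>laurent_ring R\<^esub> h
      = f \<otimes>\<^bsub>laurent_ring R\<^esub> h \<oplus>\<^bsub>laurent_ring R\<^esub> g \<otimes>\<^bsub>laurent_ring R\<^esub> h" (is ?l)
    and "h \<otimes>\<^bsub>laurent_ring R\<^esub> (f \<oplus>\<^bsub>laurent_ring R\<^esub> g)
      = h \<otimes>\<^bsub>laurent_ring R\<^esub> f \<oplus>\<^bsub>laurent_ring R\<^esub> h \<otimes>\<^bsub>laurent_ring R\<^esub> g" (is ?r)
proof -
  have c [simp]: "f m \<in> carrier R" "g m \<in> carrier R" "h m \<in> carrier R" for m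
    using f g h by (auto simp: lsupp_ge_def)
  show ?l
  proof
    fix n
    \<comment> \<open>The union contains the ranges of all three products, so they can be compared
      termwise.\<close>
    let ?A = "{F..n - H} \<union> {G..n - H}"
    have "((f \<oplus>\<^bsub>laurent_ring R\<^esub> g) \<otimes>\<^bsub>laurent_ring R\<^esub> h) n
        = (\<Oplus>m\<in>?A. (f m \<oplus> g m) \<otimes> h (n - m))"
      by (subst laurent_mult[OF laurent_add_supp[OF f g] h, of ?A])
        (auto simp: laurent_ring_sel min_def)
    also have "\<dots> = (\<Oplus>m\<in>?A. f m \<otimes> h (n - m)) \<oplus> (\<Oplus>m\<in>?A. g m \<otimes> h (n - m))"
      by (simp add: l_distr finsum_addf)
    finally show "((f \<oplus>\<^bsub>laurent_ring R\<^esub> g) \<otimes>\<^bsub>laurent_ring R\<^esub> h) n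
        = (f \<otimes>\<^bsub>laurent_ring R\<^esub> h \<oplus>\<^bsub>laurent_ring R\<^esub> g \<otimes>\<^bsub>laurent_ring R\<^esub> h) n"
      using laurent_mult[OF f h, of ?A n] laurent_mult[OF g h, of ?A n]
      by (simp add: laurent_ring_sel(3))
  qed
  show ?r
  proof
    fix n
    let ?A = "{H..n - F} \<union> {H..n - G}"
    have "(h \<otimes>\<^bsub>laurent_ring R\<^esub> (f \<oplus>\<^bsub>laurent_ring R\<^esub> g)) n
        = (\<Oplus>m\<in>?A. h m \<otimes> (f (n - m) \<oplus> g (n - m)))"
      by (subst laurent_mult[OF h laurent_add_supp[OF f g], of ?A])
        (auto simp: laurent_ring_sel min_def)
    also have "\<dots> = (\<Oplus>m\<in>?A. h m \<otimes> f (n - m)) \<oplus> (\<Oplus>m\<in>?A. h m \<otimes> g (n - m))"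
      by (simp add: r_distr finsum_addf)
    finally show "(h \<otimes>\<^bsub>laurent_ring R\<^esub> (f \<oplus>\<^bsub>laurent_ring R\<^esub> g)) n
        = (h \<otimes>\<^bsub>laurent_ring R\<^esub> f \<oplus>\<^bsub>laurent_ring R\<^esub> h \<otimes>\<^bsub>laurent_ring R\<^esub> g) n"
      using laurent_mult[OF h f, of ?A n] laurent_mult[OF h g, of ?A n]
      by (simp add: laurent_ring_sel(3))
  qed
qed

lemma laurent_monom_closed:
  "a \<in> carrier R \<Longrightarrow> (\<lambda>m. if m = k then a else \<zero>) \<in> carrier (laurent_ring R)"
  unfolding laurent_carrier_iff by (auto simp: lsupp_ge_def)

lemma laurent_ring_is_ring: "ring (laurent_ring R)"
proof (rule ringI)
  let ?L = "laurent_ring R"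
  show "abelian_group ?L"
  proof (rule abelian_groupI)
    fix f assume f: "f \<in> carrier ?L"
    then have "(\<lambda>n. \<ominus> f n) \<in> carrier ?L"
      by (auto simp: laurent_ring_def)
    moreover have "(\<lambda>n. \<ominus> f n) \<oplus>\<^bsub>?L\<^esub> f = \<zero>\<^bsub>?L\<^esub>"
      using f by (auto simp: laurent_ring_def l_neg)
    ultimately show "\<exists>g\<in>carrier ?L. g \<oplus>\<^bsub>?L\<^esub> f = \<zero>\<^bsub>?L\<^esub>" by blast
  next
    fix f g assume "f \<in> carrier ?L" "g \<in> carrier ?L"
    then show "f \<oplus>\<^bsub>?L\<^esub> g \<in> carrier ?L"
      unfolding laurent_carrier_iff using laurent_add_supp by blast
  qed (auto simp: laurent_ring_def a_ac)
  show "monoid ?L"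
  proof (rule monoidI)
    fix f g assume "f \<in> carrier ?L" "g \<in> carrier ?L"
    then show "f \<otimes>\<^bsub>?L\<^esub> g \<in> carrier ?L"
      unfolding laurent_carrier_iff using laurent_mult_supp by blast
  next
    fix f assume "f \<in> carrier ?L"
    then show "\<one>\<^bsub>?L\<^esub> \<otimes>\<^bsub>?L\<^esub> f = f" "f \<otimes>\<^bsub>?L\<^esub> \<one>\<^bsub>?L\<^esub> = f"
      by (simp_all add: laurent_ring_sel laurent_monom_mult laurent_carrier_nth)
  next
    fix f g h assume "f \<in> carrier ?L" "g \<in> carrier ?L" "h \<in> carrier ?L"
    then show "f \<otimes>\<^bsub>?L\<^esub> g \<otimes>\<^bsub>?L\<^esub> h = f \<otimes>\<^bsub>?L\<^esub> (g \<otimes>\<^bsub>?L\<^esub> h)"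
      unfolding laurent_carrier_iff using laurent_mult_assoc by blast
  qed (simp add: laurent_ring_sel laurent_monom_closed)
  fix f g h assume "f \<in> carrier ?L" "g \<in> carrier ?L" "h \<in> carrier ?L"
  then show "(f \<oplus>\<^bsub>?L\<^esub> g) \<otimes>\<^bsub>?L\<^esub> h = f \<otimes>\<^bsub>?L\<^esub> h \<oplus>\<^bsub>?L\<^esub> g \<otimes>\<^bsub>?L\<^esub> h"
      "h \<otimes>\<^bsub>?L\<^esub> (f \<oplus>\<^bsub>?L\<^esub> g) = h \<otimes>\<^bsub>?L\<^esub> f \<oplus>\<^bsub>?L\<^esub> h \<otimes>\<^bsub>?L\<^esub> g"
    unfolding laurent_carrier_iff using laurent_distr by blast+
qed

lemma laurent_const_hom: "laurent_const R \<in> ring_hom R (laurent_ring R)"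
proof (rule ring_hom_memI)
  fix a b assume "a \<in> carrier R" "b \<in> carrier R"
  then show "laurent_const R (a \<otimes> b) = laurent_const R a \<otimes>\<^bsub>laurent_ring R\<^esub> laurent_const R b"
      "laurent_const R (a \<oplus> b) = laurent_const R a \<oplus>\<^bsub>laurent_ring R\<^esub> laurent_const R b"
    by (auto simp: laurent_const_def laurent_monom_mult laurent_monom_closed laurent_ring_sel)
qed (simp_all add: laurent_const_def laurent_monom_closed laurent_ring_sel)

lemma laurent_u_closed: "laurent_u R \<in> carrier (laurent_ring R)"
  by (simp add: laurent_u_def laurent_monom_closed)

lemma laurent_u_mult:
  assumes "f \<in> carrier (laurent_ring R)"
  shows "laurent_u R \<otimes>\<^bsub>laurent_ring R\<^esub> f = (\<lambda>n. f (n + 1))"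
    and "f \<otimes>\<^bsub>laurent_ring R\<^esub> laurent_u R = (\<lambda>n. f (n + 1))"
  using assms by (simp_all add: laurent_u_def laurent_monom_mult laurent_carrier_nth)

lemma laurent_a_minus:
  assumes f: "f \<in> carrier (laurent_ring R)" and g: "g \<in> carrier (laurent_ring R)"
  shows "f \<ominus>\<^bsub>laurent_ring R\<^esub> g = (\<lambda>n. f n \<ominus> g n)"
proof -
  interpret L: ring "laurent_ring R" by (rule laurent_ring_is_ring)
  have "(\<lambda>n. \<ominus> g n) \<in> carrier (laurent_ring R)"
    using g by (auto simp: laurent_ring_def)
  moreover have "(\<lambda>n. \<ominus> g n) \<oplus>\<^bsub>laurent_ring R\<^esub> g = \<zero>\<^bsub>laurent_ring R\<^esub>"
    using g by (auto simp: laurent_ring_def l_neg)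
  ultimately have "\<ominus>\<^bsub>laurent_ring R\<^esub> g = (\<lambda>n. \<ominus> g n)"
    using g by (simp add: L.minus_equality)
  then show ?thesis
    by (simp add: L.minus_eq laurent_ring_sel a_minus_def)
qed

section \<open>Expansions of \<open>1 / (c u - a)\<close>\<close>

lemma geometric_series_closed:
  assumes "h \<in> carrier R" "a \<in> carrier R"
  shows "(\<lambda>n. if n \<ge> 1 then h [^] nat n \<otimes> a [^] nat (n - 1) else \<zero>) \<in> carrier (laurent_ring R)"
  using assms unfolding laurent_carrier_iff
  by (intro exI[of _ 1]) (auto simp: lsupp_ge_def simp del: pow_nat)

text \<open>With \<open>h = 1 / c\<close>, the series \<open>G\<close> is the expansion of
  \<open>1 / (c u - a)\<close>, whose coefficients are
  \<open>c\<^sup>-\<^sup>n a\<^sup>n\<^sup>-\<^sup>1\<close>. Multiplication by \<open>u\<close>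
  shifts coefficients by one, so the coefficient of \<open>v G\<close> at \<open>n\<close> is
  \<open>c G (n + 1) - a G n\<close>, which telescopes. The cases \<open>c = 1\<close> and
  \<open>c = 2\<close> give the two reciprocals of the theorem.\<close>

lemma geometric_series_inverse:
  assumes a [simp]: "a \<in> carrier R" and h [simp]: "h \<in> carrier R" and c [simp]: "c \<in> carrier R"
    and hc: "h \<otimes> c = \<one>" "c \<otimes> h = \<one>" and ac: "a \<otimes> c = c \<otimes> a" and ah: "a \<otimes> h = h \<otimes> a"
  defines "G \<equiv> \<lambda>n::int. if n \<ge> 1 then h [^] nat n \<otimes> a [^] nat (n - 1) else \<zero>"
    and "v \<equiv> (\<lambda>m::int. if m = - 1 then c else \<zero>) \<ominus>\<^bsub>laurent_ring R\<^esub> laurent_const R a"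
  shows "v \<otimes>\<^bsub>laurent_ring R\<^esub> G = \<one>\<^bsub>laurent_ring R\<^esub>"
    and "G \<otimes>\<^bsub>laurent_ring R\<^esub> v = \<one>\<^bsub>laurent_ring R\<^esub>"
proof -
  let ?L = "laurent_ring R"
  let ?cu = "\<lambda>m::int. if m = - 1 then c else \<zero>" and ?a = "laurent_const R a"
  interpret L: ring ?L by (rule laurent_ring_is_ring)
  have G [simp]: "G \<in> carrier ?L"
    unfolding G_def by (rule geometric_series_closed) simp_all
  have cu [simp]: "?cu \<in> carrier ?L" by (simp add: laurent_monom_closed)
  have ca [simp]: "?a \<in> carrier ?L" by (simp add: laurent_const_def laurent_monom_closed)
  have pow_a: "a [^] n \<otimes> a = a \<otimes> a [^] n" for n :: nat
    using nat_pow_Suc2[OF a, of n] by simp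
  have pow_c: "a [^] n \<otimes> c = c \<otimes> a [^] n" for n :: nat
  proof (induction n)
    case (Suc n)
    have "a [^] Suc n \<otimes> c = (a [^] n \<otimes> c) \<otimes> a"
      by (simp add: m_assoc ac)
    then show ?case by (simp add: Suc m_assoc)
  qed simp
  have pow_h: "h [^] n \<otimes> a = a \<otimes> h [^] n" for n :: nat
  proof (induction n)
    case (Suc n)
    have "h [^] Suc n \<otimes> a = (h [^] n \<otimes> a) \<otimes> h"
      by (simp add: m_assoc ah)
    then show ?case by (simp add: Suc m_assoc)
  qed simp
  have G_Suc: "G (int n + 1) = h [^] Suc n \<otimes> a [^] n" for n
    by (simp add: G_def nat_add_distrib del: pow_nat nat_pow_Suc)
  \<comment> \<open>Passing from \<open>n\<close> to \<open>n + 1\<close> adds one factor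
    \<open>h\<close>, which \<open>c\<close> cancels, and one factor \<open>a\<close>. The bound
    \<open>n \<ge> 1\<close> matters: at \<open>n = 0\<close> the left side is
    \<open>c h = 1\<close> while \<open>G 0\<close> is zero, and this is where the unit coefficient
    of the product comes from.\<close>
  have step: "c \<otimes> G (n + 1) = a \<otimes> G n" "G (n + 1) \<otimes> c = G n \<otimes> a" if "n \<ge> 1" for n
  proof -
    obtain m where n: "n = int m + 1"
      using \<open>n \<ge> 1\<close> by (metis add.commute zle_iff_zadd of_nat_1)
    have "G (n + 1) = h [^] Suc (Suc m) \<otimes> a [^] Suc m"
      using G_Suc[of "Suc m"] by (simp add: n add.commute del: nat_pow_Suc)
    then have 1: "G (n + 1) = h \<otimes> (h [^] Suc m \<otimes> a [^] Suc m)"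
      unfolding nat_pow_Suc2[OF h, of "Suc m"] by (simp add: m_assoc del: nat_pow_Suc)
    have "c \<otimes> G (n + 1) = h [^] Suc m \<otimes> a [^] Suc m"
      unfolding 1 using hc by (simp flip: m_assoc del: nat_pow_Suc)
    also have "\<dots> = (h [^] Suc m \<otimes> a) \<otimes> a [^] m"
      by (simp add: pow_a m_assoc)
    also have "\<dots> = a \<otimes> G n"
      unfolding pow_h n G_Suc by (simp add: m_assoc del: nat_pow_Suc)
    finally show "c \<otimes> G (n + 1) = a \<otimes> G n" .
    have "G (n + 1) = h [^] Suc m \<otimes> h \<otimes> a [^] Suc m"
      using G_Suc[of "Suc m"] by (simp add: n add.commute)
    then have "G (n + 1) \<otimes> c = h [^] Suc m \<otimes> (h \<otimes> c) \<otimes> a [^] Suc m"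
      using pow_c[of "Suc m"] by (simp add: m_assoc del: nat_pow_Suc)
    also have "\<dots> = G n \<otimes> a"
      unfolding hc n G_Suc by (simp add: m_assoc)
    finally show "G (n + 1) \<otimes> c = G n \<otimes> a" .
  qed
  have G_1: "G 1 = h"
    by (simp add: G_def)
  have "v \<otimes>\<^bsub>?L\<^esub> G = ?cu \<otimes>\<^bsub>?L\<^esub> G \<ominus>\<^bsub>?L\<^esub> ?a \<otimes>\<^bsub>?L\<^esub> G"
    unfolding v_def using G cu ca by (simp add: L.minus_eq L.l_distr L.r_distr L.l_minus L.r_minus)
  also have "\<dots> = (\<lambda>n. c \<otimes> G (n + 1) \<ominus> a \<otimes> G n)"
    using laurent_a_minus[OF L.m_closed[OF cu G] L.m_closed[OF ca G]]
    by (simp add: laurent_const_def laurent_monom_mult)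
  also have "\<dots> = \<one>\<^bsub>?L\<^esub>"
  proof
    fix n :: int
    consider "n \<ge> 1" | "n = 0" | "n < 0" by linarith
    then show "c \<otimes> G (n + 1) \<ominus> a \<otimes> G n = \<one>\<^bsub>?L\<^esub> n"
    proof cases
      case 1
      then show ?thesis
        using step(1)[OF 1] laurent_carrier_nth[OF G, of n] by (simp add: laurent_ring_sel minus_eq r_neg)
    next
      case 2
      then show ?thesis
        by (simp add: laurent_ring_sel minus_eq hc G_1) (simp add: G_def)
    next
      case 3
      then show ?thesis
        by (simp add: laurent_ring_sel minus_eq G_def)
    qed
  qed
  finally show "v \<otimes>\<^bsub>?L\<^esub> G = \<one>\<^bsub>?L\<^esub>" .
  have "G \<otimes>\<^bsub>?L\<^esub> v = G \<otimes>\<^bsub>?L\<^esub> ?cu \<ominus>\<^bsub>?L\<^esub> G \<otimes>\<^bsub>?L\<^esub> ?a"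
    unfolding v_def using G cu ca by (simp add: L.minus_eq L.l_distr L.r_distr L.l_minus L.r_minus)
  also have "\<dots> = (\<lambda>n. G (n + 1) \<otimes> c \<ominus> G n \<otimes> a)"
    using laurent_a_minus[OF L.m_closed[OF G cu] L.m_closed[OF G ca]]
    by (simp add: laurent_const_def laurent_monom_mult)
  also have "\<dots> = \<one>\<^bsub>?L\<^esub>"
  proof
    fix n :: int
    consider "n \<ge> 1" | "n = 0" | "n < 0" by linarith
    then show "G (n + 1) \<otimes> c \<ominus> G n \<otimes> a = \<one>\<^bsub>?L\<^esub> n"
    proof cases
      case 1
      then show ?thesis
        using step(2)[OF 1] laurent_carrier_nth[OF G, of n] by (simp add: laurent_ring_sel minus_eq r_neg)
    next
      case 2
      then show ?thesis
        by (simp add: laurent_ring_sel minus_eq hc G_1) (simp add: G_def)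
    next
      case 3
      then show ?thesis
        by (simp add: laurent_ring_sel minus_eq G_def)
    qed
  qed
  finally show "G \<otimes>\<^bsub>?L\<^esub> v = \<one>\<^bsub>?L\<^esub>" .
qed

text \<open>The trivial factor \<open>\<one> [^] nat n\<close> puts the series into the geometric
  shape with \<open>h = c = 1\<close>.\<close>

lemma recip_u_minus_eq:
  "a \<in> carrier R \<Longrightarrow>
    recip_u_minus R a = (\<lambda>n. if n \<ge> 1 then \<one> [^] nat n \<otimes> a [^] nat (n - 1) else \<zero>)"
  by (auto simp: recip_u_minus_def simp del: pow_nat)

lemma recip_u_minus_inverse:
  assumes a: "a \<in> carrier R"
  shows "recip_u_minus R a \<in> carrier (laurent_ring R)"
    and "(laurent_u R \<ominus>\<^bsub>laurent_ring R\<^esub> laurent_const R a) \<otimes>\<^bsub>laurent_ring R\<^esub> recip_u_minus R a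
      = \<one>\<^bsub>laurent_ring R\<^esub>"
    and "recip_u_minus R a \<otimes>\<^bsub>laurent_ring R\<^esub> (laurent_u R \<ominus>\<^bsub>laurent_ring R\<^esub> laurent_const R a)
      = \<one>\<^bsub>laurent_ring R\<^esub>"
  using geometric_series_closed[of \<one> a] geometric_series_inverse[of a \<one> \<one>] a
  by (simp_all add: recip_u_minus_eq laurent_u_def)

lemma two_commutes: "a \<in> carrier R \<Longrightarrow> a \<otimes> ([(2::nat)] \<cdot> \<one>) = ([(2::nat)] \<cdot> \<one>) \<otimes> a"
  by (simp add: add_pow_ldistr add_pow_rdistr)

lemma laurent_two_u: "[(2::nat)] \<cdot>\<^bsub>laurent_ring R\<^esub> laurent_u R
    = (\<lambda>m. if m = - 1 then [(2::nat)] \<cdot> \<one> else \<zero>)"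
proof -
  interpret L: ring "laurent_ring R" by (rule laurent_ring_is_ring)
  have "[(2::nat)] \<cdot>\<^bsub>laurent_ring R\<^esub> laurent_u R = laurent_u R \<oplus>\<^bsub>laurent_ring R\<^esub> laurent_u R"
    using laurent_u_closed by (simp add: numeral_2_eq_2)
  also have "\<dots> = (\<lambda>m. if m = - 1 then [(2::nat)] \<cdot> \<one> else \<zero>)"
    by (auto simp: laurent_ring_sel laurent_u_def numeral_2_eq_2)
  finally show ?thesis .
qed

lemma recip_2u_minus_inverse:
  assumes a: "a \<in> carrier R" and two: "[(2::nat)] \<cdot> \<one> \<in> Units R"
  defines "w \<equiv> [(2::nat)] \<cdot>\<^bsub>laurent_ring R\<^esub> laurent_u R \<ominus>\<^bsub>laurent_ring R\<^esub> laurent_const R a"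
  shows "recip_2u_minus R a \<in> carrier (laurent_ring R)"
    and "w \<otimes>\<^bsub>laurent_ring R\<^esub> recip_2u_minus R a = \<one>\<^bsub>laurent_ring R\<^esub>"
    and "recip_2u_minus R a \<otimes>\<^bsub>laurent_ring R\<^esub> w = \<one>\<^bsub>laurent_ring R\<^esub>"
proof -
  let ?c = "[(2::nat)] \<cdot> \<one>"
  have h: "inv ?c \<in> carrier R" "inv ?c \<otimes> ?c = \<one>" "?c \<otimes> inv ?c = \<one>"
    using two by simp_all
  \<comment> \<open>As an integer multiple of \<open>1\<close>, the element \<open>2\<close> is
    central, and so is its inverse, although \<open>a\<close> lies in a noncommutative ring.\<close>
  have "a \<otimes> inv ?c = inv ?c \<otimes> a"
    using inverse_commutes[of a ?c "inv ?c"] h a two_commutes[OF a] by simp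
  then show "recip_2u_minus R a \<in> carrier (laurent_ring R)"
    "w \<otimes>\<^bsub>laurent_ring R\<^esub> recip_2u_minus R a = \<one>\<^bsub>laurent_ring R\<^esub>"
    "recip_2u_minus R a \<otimes>\<^bsub>laurent_ring R\<^esub> w = \<one>\<^bsub>laurent_ring R\<^esub>"
    using geometric_series_closed[of "inv ?c" a] geometric_series_inverse[of a "inv ?c" ?c] a h two_commutes[OF a]
    by (simp_all add: recip_2u_minus_def w_def laurent_two_u del: pow_nat)
qed

end

section \<open>The degenerate affine BMW algebra\<close>

context ring begin

text \<open>Constants embed homomorphically and \<open>u\<close> is central, so the relations among
  \<open>t\<close>, \<open>e\<close>, \<open>y\<close>, \<open>y'\<close> become the hypotheses of
  \<open>BMW_series_identities\<close> for \<open>v = u - y\<close> and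
  \<open>v' = u - y'\<close>.\<close>

lemma laurent_BMW_identities:
  assumes [simp]: "t \<in> carrier R" "e \<in> carrier R" "y \<in> carrier R" "y' \<in> carrier R" "\<epsilon> \<in> carrier R"
    and two: "[(2::nat)] \<cdot> \<one> \<in> Units R"
    and \<epsilon>: "\<epsilon> \<in> {\<one>, \<ominus> \<one>}"
    and tt: "t \<otimes> t = \<one>" and et: "e \<otimes> t = \<epsilon> \<otimes> e" and te: "t \<otimes> e = \<epsilon> \<otimes> e"
    and e: "e = \<one> \<ominus> (y' \<otimes> t \<ominus> t \<otimes> y)"
    and yy': "y \<otimes> y' = y' \<otimes> y" and t_sum: "t \<otimes> (y \<oplus> y') = (y \<oplus> y') \<otimes> t"
  shows
    "let L = laurent_ring R; u = laurent_u R; a = laurent_const R (y \<oplus> y');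
         t = laurent_const R t; e = laurent_const R e; eps = laurent_const R \<epsilon>;
         U = recip_u_minus R y; U' = recip_u_minus R y'; D = recip_2u_minus R (y \<oplus> y')
     in
       (e \<otimes>\<^bsub>L\<^esub> U' \<ominus>\<^bsub>L\<^esub> t \<ominus>\<^bsub>L\<^esub> D) \<otimes>\<^bsub>L\<^esub> (e \<otimes>\<^bsub>L\<^esub> U \<oplus>\<^bsub>L\<^esub> t \<ominus>\<^bsub>L\<^esub> D)
         = (\<ominus>\<^bsub>L\<^esub> (([(2::nat)] \<cdot>\<^bsub>L\<^esub> u \<ominus>\<^bsub>L\<^esub> a \<oplus>\<^bsub>L\<^esub> \<one>\<^bsub>L\<^esub>) \<otimes>\<^bsub>L\<^esub> ([(2::nat)] \<cdot>\<^bsub>L\<^esub> u \<ominus>\<^bsub>L\<^esub> a \<ominus>\<^bsub>L\<^esub> \<one>\<^bsub>L\<^esub>)))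
             \<otimes>\<^bsub>L\<^esub> D [^]\<^bsub>L\<^esub> (2::nat)
       \<and> (U' \<oplus>\<^bsub>L\<^esub> t \<ominus>\<^bsub>L\<^esub> e \<otimes>\<^bsub>L\<^esub> D) \<ominus>\<^bsub>L\<^esub> U \<otimes>\<^bsub>L\<^esub> (U' \<oplus>\<^bsub>L\<^esub> t \<ominus>\<^bsub>L\<^esub> e \<otimes>\<^bsub>L\<^esub> D) \<otimes>\<^bsub>L\<^esub> U
         = (t \<otimes>\<^bsub>L\<^esub> U \<otimes>\<^bsub>L\<^esub> t \<oplus>\<^bsub>L\<^esub> t \<ominus>\<^bsub>L\<^esub> e \<otimes>\<^bsub>L\<^esub> D)
             \<ominus>\<^bsub>L\<^esub> U' \<otimes>\<^bsub>L\<^esub> (e \<otimes>\<^bsub>L\<^esub> U \<otimes>\<^bsub>L\<^esub> e \<oplus>\<^bsub>L\<^esub> eps \<otimes>\<^bsub>L\<^esub> e \<ominus>\<^bsub>L\<^esub> e \<otimes>\<^bsub>L\<^esub> D) \<otimes>\<^bsub>L\<^esub> U'"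
proof -
  define L where "L = laurent_ring R"
  define c where "c = laurent_const R"
  define u where "u = laurent_u R"
  define v where "v = u \<ominus>\<^bsub>L\<^esub> c y"
  define v' where "v' = u \<ominus>\<^bsub>L\<^esub> c y'"
  define U where "U = recip_u_minus R y"
  define U' where "U' = recip_u_minus R y'"
  define D where "D = recip_2u_minus R (y \<oplus> y')"
  interpret L: ring L unfolding L_def by (rule laurent_ring_is_ring)
  interpret c: ring_hom_ring R L c
    unfolding c_def L_def
    by (intro ring_hom_ringI2 ring_axioms laurent_ring_is_ring laurent_const_hom)
  have u [simp]: "u \<in> carrier L" by (simp add: u_def L_def laurent_u_closed)
  have v [simp]: "v \<in> carrier L" "v' \<in> carrier L" by (simp_all add: v_def v'_def)
  have U: "U \<in> carrier L" "v \<otimes>\<^bsub>L\<^esub> U = \<one>\<^bsub>L\<^esub>" "U \<otimes>\<^bsub>L\<^esub> v = \<one>\<^bsub>L\<^esub>"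
    using recip_u_minus_inverse[of y] by (simp_all add: U_def L_def v_def u_def c_def)
  have U': "U' \<in> carrier L" "v' \<otimes>\<^bsub>L\<^esub> U' = \<one>\<^bsub>L\<^esub>" "U' \<otimes>\<^bsub>L\<^esub> v' = \<one>\<^bsub>L\<^esub>"
    using recip_u_minus_inverse[of y'] by (simp_all add: U'_def L_def v'_def u_def c_def)
  have two_u: "[(2::nat)] \<cdot>\<^bsub>L\<^esub> u = u \<oplus>\<^bsub>L\<^esub> u"
    by (simp add: numeral_2_eq_2)
  have cy: "c y \<in> carrier L" "c y' \<in> carrier L" "c t \<in> carrier L" "c e \<in> carrier L" by simp_all
  \<comment> \<open>This identifies the denominator of \<open>recip_2u_minus\<close> with
    \<open>v + v'\<close>, which makes \<open>D\<close> its inverse.\<close>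
  have sum: "[(2::nat)] \<cdot>\<^bsub>L\<^esub> u \<ominus>\<^bsub>L\<^esub> c (y \<oplus> y') = v \<oplus>\<^bsub>L\<^esub> v'"
    unfolding v_def v'_def two_u c.hom_add[OF assms(3,4)] using u cy by algebra
  have D: "D \<in> carrier L" "(v \<oplus>\<^bsub>L\<^esub> v') \<otimes>\<^bsub>L\<^esub> D = \<one>\<^bsub>L\<^esub>" "D \<otimes>\<^bsub>L\<^esub> (v \<oplus>\<^bsub>L\<^esub> v') = \<one>\<^bsub>L\<^esub>"
    using recip_2u_minus_inverse[OF _ two, of "y \<oplus> y'"]
    unfolding sum[symmetric] unfolding D_def L_def u_def c_def by simp_all
  have u_central: "u \<otimes>\<^bsub>L\<^esub> x = x \<otimes>\<^bsub>L\<^esub> u" if "x \<in> carrier L" for x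
    using that by (simp add: L_def u_def laurent_u_mult)
  have hom_minus: "c (x \<ominus> x') = c x \<ominus>\<^bsub>L\<^esub> c x'" if "x \<in> carrier R" "x' \<in> carrier R" for x x'
    using that by (simp add: minus_eq L.minus_eq)
  have \<epsilon>': "c \<epsilon> \<in> {\<one>\<^bsub>L\<^esub>, \<ominus>\<^bsub>L\<^esub> \<one>\<^bsub>L\<^esub>}"
    using \<epsilon> by auto
  have rels: "c t \<otimes>\<^bsub>L\<^esub> c t = \<one>\<^bsub>L\<^esub>" "c e \<otimes>\<^bsub>L\<^esub> c t = c \<epsilon> \<otimes>\<^bsub>L\<^esub> c e" "c t \<otimes>\<^bsub>L\<^esub> c e = c \<epsilon> \<otimes>\<^bsub>L\<^esub> c e"
    using tt et te by (simp_all flip: c.hom_mult)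
  have "c e = \<one>\<^bsub>L\<^esub> \<ominus>\<^bsub>L\<^esub> (c y' \<otimes>\<^bsub>L\<^esub> c t \<ominus>\<^bsub>L\<^esub> c t \<otimes>\<^bsub>L\<^esub> c y)"
    by (subst e) (simp add: hom_minus)
  also have "\<dots> = \<one>\<^bsub>L\<^esub> \<oplus>\<^bsub>L\<^esub> v' \<otimes>\<^bsub>L\<^esub> c t \<ominus>\<^bsub>L\<^esub> c t \<otimes>\<^bsub>L\<^esub> v"
  proof -
    \<comment> \<open>With \<open>u\<close> moved to the right of \<open>t\<close>, it cancels
      against the \<open>u\<close> in \<open>t v\<close>. Replacing \<open>y\<close> by
      \<open>u - y\<close> thus only flips the sign of \<open>y' t - t y\<close>.\<close>
    have "v' \<otimes>\<^bsub>L\<^esub> c t = c t \<otimes>\<^bsub>L\<^esub> u \<ominus>\<^bsub>L\<^esub> c y' \<otimes>\<^bsub>L\<^esub> c t"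
      using u_central[of "c t"] by (simp add: v'_def L.minus_eq L.l_distr L.l_minus)
    then show ?thesis
      unfolding v_def using u cy by (simp only:) algebra
  qed
  finally have e': "c e = \<one>\<^bsub>L\<^esub> \<oplus>\<^bsub>L\<^esub> v' \<otimes>\<^bsub>L\<^esub> c t \<ominus>\<^bsub>L\<^esub> c t \<otimes>\<^bsub>L\<^esub> v" .
  have cyy': "c y \<otimes>\<^bsub>L\<^esub> c y' = c y' \<otimes>\<^bsub>L\<^esub> c y"
    using yy' by (simp flip: c.hom_mult)
  have vv': "v \<otimes>\<^bsub>L\<^esub> v' = v' \<otimes>\<^bsub>L\<^esub> v"
    using u_central[of "c y"] u_central[of "c y'"] cyy'
    by (simp add: v_def v'_def L.minus_eq L.l_distr L.r_distr L.l_minus L.r_minus L.minus_add L.a_ac)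
  have "c t \<otimes>\<^bsub>L\<^esub> c (y \<oplus> y') = c (y \<oplus> y') \<otimes>\<^bsub>L\<^esub> c t"
    using t_sum by (simp flip: c.hom_mult c.hom_add)
  then have t_sum': "c t \<otimes>\<^bsub>L\<^esub> (v \<oplus>\<^bsub>L\<^esub> v') = (v \<oplus>\<^bsub>L\<^esub> v') \<otimes>\<^bsub>L\<^esub> c t"
    unfolding sum[symmetric] two_u using u_central[of "c t"]
    by (simp add: L.minus_eq L.l_distr L.r_distr L.l_minus L.r_minus del: c.hom_add)
  have sq: "D [^]\<^bsub>L\<^esub> (2::nat) = D \<otimes>\<^bsub>L\<^esub> D"
    using D by (simp add: numeral_2_eq_2)
  note I = L.BMW_series_identities[OF cy(3,4) v U(1) U'(1) D(1) c.hom_closed[OF assms(5)] \<epsilon>' rels e' vv' t_sum'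
      U(2,3) U'(2,3) D(2,3)]
  show ?thesis
    using I unfolding Let_def sq[symmetric] sum[symmetric]
    unfolding L_def c_def u_def U_def U'_def D_def by blast
qed

text \<open>For \<open>q = 1 - p\<close> we have \<open>q t = t q = 0\<close> and \<open>e q = \<epsilon> e t q = 0\<close>, so the formula for \<open>e\<close> times \<open>q\<close> gives
  \<open>q = - t y q\<close>, whence \<open>q = q q = 0\<close>.\<close>

lemma BMW_idempotent_eq_one:
  assumes [simp]: "p \<in> carrier R" "t \<in> carrier R" "e \<in> carrier R" "y \<in> carrier R" "y' \<in> carrier R"
    and \<epsilon>: "\<epsilon> \<in> {\<one>, \<ominus> \<one>}"
    and pp: "p \<otimes> p = p" and pt: "p \<otimes> t = t" and tp: "t \<otimes> p = t"
    and et: "e \<otimes> t = \<epsilon> \<otimes> e" and e: "e = \<one> \<ominus> (y' \<otimes> t \<ominus> t \<otimes> y)"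
  shows "p = \<one>"
proof -
  define q where "q = \<one> \<ominus> p"
  have q [simp]: "q \<in> carrier R" by (simp add: q_def)
  have qt: "q \<otimes> t = \<zero>" and tq: "t \<otimes> q = \<zero>"
    by (simp_all add: q_def minus_eq l_distr r_distr l_minus r_minus pt tp r_neg)
  have "e = \<epsilon> \<otimes> (e \<otimes> t)"
    unfolding et using \<epsilon> by (auto simp: l_minus)
  then have "e \<otimes> q = \<epsilon> \<otimes> (e \<otimes> t) \<otimes> q"
    by (rule arg_cong[where f = "\<lambda>x. x \<otimes> q"])
  also have "\<dots> = \<zero>"
    using \<epsilon> by (auto simp: m_assoc tq)
  finally have eq: "e \<otimes> q = \<zero>" .
  have "q \<oplus> t \<otimes> y \<otimes> q = e \<otimes> q \<oplus> y' \<otimes> (t \<otimes> q)"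
    unfolding e using assms(1-5) q by algebra
  also have "\<dots> = \<zero>"
    by (simp add: eq tq)
  finally have "q \<otimes> (q \<oplus> t \<otimes> y \<otimes> q) = \<zero>"
    by simp
  then have "q \<otimes> q \<oplus> (q \<otimes> t) \<otimes> (y \<otimes> q) = \<zero>"
    by (simp add: r_distr m_assoc)
  moreover have "q \<otimes> q = q"
    by (simp add: q_def minus_eq l_distr r_distr l_minus r_minus pp l_neg r_neg)
  ultimately have q0: "q = \<zero>"
    by (simp add: qt)
  have "\<one> = q \<oplus> p"
    unfolding q_def using assms(1) by algebra
  then show ?thesis
    using q0 by simp
qed

section \<open>From the presentation to the quotient algebras\<close>

lemma gamma_closed:
  assumes "t (adj i) \<in> carrier R" "y i \<in> carrier R" "y (i + 1) \<in> carrier R"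
  shows "gamma R t y i \<in> carrier R"
  using assms by (simp add: gamma_def)

end

lemma adj_in_sym_group: "j \<in> {1..<k} \<Longrightarrow> adj j \<in> carrier (sym_group k)"
  unfolding sym_group_carrier by (rule permutes_swap_id) auto

text \<open>The facts about \<open>rel_quot\<close> and \<open>rel_class\<close> apply to relations
  between elements of the carrier. This lemma supplies that for the braid relations, and the next
  one for the BMW relations.\<close>

lemma (in ring) braid_rels_closed:
  assumes t: "\<And>w. w \<in> carrier (sym_group k) \<Longrightarrow> t w \<in> carrier R"
    and \<kappa>: "\<kappa>0 \<in> carrier R" "\<kappa>1 \<in> carrier R"
    and y: "\<And>j. j \<in> {1..k} \<Longrightarrow> y j \<in> carrier R"
  shows "braid_rels R k t \<kappa>0 \<kappa>1 y \<subseteq> carrier R \<times> carrier R"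
proof -
  have adj: "t (adj j) \<in> carrier R" if "j \<in> {1..<k}" for j
    using t adj_in_sym_group[OF that] by blast
  interpret S: group "sym_group k" by (rule sym_group_is_group)
  have "a \<in> carrier R \<and> b \<in> carrier R" if "(a, b) \<in> braid_rels R k t \<kappa>0 \<kappa>1 y" for a b
    using that
  proof (induction rule: braid_rels.induct)
    case (t_gamma i)
    then have "t (adj i) \<in> carrier R" "t (adj (i + 1)) \<in> carrier R"
        "y i \<in> carrier R" "y (i + 1) \<in> carrier R" "y (i + 2) \<in> carrier R"
      using adj[of i] adj[of "i + 1"] y[of i] y[of "i + 1"] y[of "i + 2"] by simp_all
    then show ?case
      using gamma_closed[of t i y] gamma_closed[of t "i + 1" y] by simp
  next
    case (t_ysum i)
    then show ?case using adj[of i] y[of i] y[of "i + 1"] by simp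
  next
    case k1_t1
    then show ?case using adj[of 1] \<kappa> by simp
  qed (use t y \<kappa> adj in simp_all)
  then show ?thesis by force
qed

lemma (in ring) BMW_rels_closed:
  assumes \<epsilon>: "\<epsilon> \<in> carrier R" and z: "\<And>l. z l \<in> carrier R"
    and s: "\<And>j. j \<in> {1..<k} \<Longrightarrow> s j \<in> carrier R" and y: "\<And>j. j \<in> {1..k} \<Longrightarrow> y j \<in> carrier R"
    and e: "\<And>j. j \<in> {1..<k} \<Longrightarrow> e j \<in> carrier R"
  shows "BMW_rels R k \<epsilon> z s y e \<subseteq> carrier R \<times> carrier R"
proof -
  have "a \<in> carrier R \<and> b \<in> carrier R" if "(a, b) \<in> BMW_rels R k \<epsilon> z s y e" for a b
    using that
  proof (induction rule: BMW_rels.induct)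
    case (e_y_e l)
    then show ?case using e[of 1] y[of 1] z by simp
  next
    case (e_ysum i)
    then show ?case using e[of i] y[of i] y[of "i + 1"] by simp
  next
    case (ysum_e i)
    then show ?case using e[of i] y[of i] y[of "i + 1"] by simp
  qed (use \<epsilon> s e in simp_all)
  then show ?thesis by force
qed

theorem proposition3p1:
  fixes C :: "('c, 'm) ring_scheme" and \<epsilon> :: 'c and z :: "nat \<Rightarrow> 'c" and i :: nat
  assumes "cring C"
    and "[(2::nat)] \<cdot>\<^bsub>C\<^esub> \<one>\<^bsub>C\<^esub> \<in> Units C"
    and "\<epsilon> \<in> {\<one>\<^bsub>C\<^esub>, \<ominus>\<^bsub>C\<^esub> \<one>\<^bsub>C\<^esub>}"
    and "\<And>l. z l \<in> carrier C"
    and "i \<ge> 1"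
  shows
    "let k = i + 1;
         W = BMW_algebra C \<epsilon> z k;
         cls = BMW_class C \<epsilon> z k;
         L = laurent_ring W;
         const = laurent_const W;
         u = laurent_u W;
         y = cls (braid_y C k i);
         y' = cls (braid_y C k (i + 1));
         a = const (y \<oplus>\<^bsub>W\<^esub> y');
         t = const (cls (braid_t C k (adj i)));
         e = const (cls (braid_e C k i));
         eps = const (cls (braid_scalar C k \<epsilon>));
         U = recip_u_minus W y;
         U' = recip_u_minus W y';
         D = recip_2u_minus W (y \<oplus>\<^bsub>W\<^esub> y')
     in
       (e \<otimes>\<^bsub>L\<^esub> U' \<ominus>\<^bsub>L\<^esub> t \<ominus>\<^bsub>L\<^esub> D) \<otimes>\<^bsub>L\<^esub> (e \<otimes>\<^bsub>L\<^esub> U \<oplus>\<^bsub>L\<^esub> t \<ominus>\<^bsub>L\<^esub> D)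
         = (\<ominus>\<^bsub>L\<^esub> (([(2::nat)] \<cdot>\<^bsub>L\<^esub> u \<ominus>\<^bsub>L\<^esub> a \<oplus>\<^bsub>L\<^esub> \<one>\<^bsub>L\<^esub>) \<otimes>\<^bsub>L\<^esub> ([(2::nat)] \<cdot>\<^bsub>L\<^esub> u \<ominus>\<^bsub>L\<^esub> a \<ominus>\<^bsub>L\<^esub> \<one>\<^bsub>L\<^esub>)))
             \<otimes>\<^bsub>L\<^esub> D [^]\<^bsub>L\<^esub> (2::nat)
       \<and> (U' \<oplus>\<^bsub>L\<^esub> t \<ominus>\<^bsub>L\<^esub> e \<otimes>\<^bsub>L\<^esub> D) \<ominus>\<^bsub>L\<^esub> U \<otimes>\<^bsub>L\<^esub> (U' \<oplus>\<^bsub>L\<^esub> t \<ominus>\<^bsub>L\<^esub> e \<otimes>\<^bsub>L\<^esub> D) \<otimes>\<^bsub>L\<^esub> U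
         = (t \<otimes>\<^bsub>L\<^esub> U \<otimes>\<^bsub>L\<^esub> t \<oplus>\<^bsub>L\<^esub> t \<ominus>\<^bsub>L\<^esub> e \<otimes>\<^bsub>L\<^esub> D)
             \<ominus>\<^bsub>L\<^esub> U' \<otimes>\<^bsub>L\<^esub> (e \<otimes>\<^bsub>L\<^esub> U \<otimes>\<^bsub>L\<^esub> e \<oplus>\<^bsub>L\<^esub> eps \<otimes>\<^bsub>L\<^esub> e \<ominus>\<^bsub>L\<^esub> e \<otimes>\<^bsub>L\<^esub> D) \<otimes>\<^bsub>L\<^esub> U'"
proof -
  define k where "k = i + 1"
  define F where "F = free_algebra C (braid_gens k)"
  define B where "B = braid_algebra C k"
  define W where "W = BMW_algebra C \<epsilon> z k"
  interpret C: cring C by fact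
  interpret F: ring F unfolding F_def by (rule C.free_algebra_is_ring)
  interpret S: group "sym_group k" by (rule sym_group_is_group)
  have gens: "free_gen C (T w) \<in> carrier F" if "w \<in> carrier (sym_group k)" for w
    using that unfolding F_def by (intro C.free_gen_closed) (simp add: braid_gens_def)
  have gens': "free_gen C (Y j) \<in> carrier F" if "j \<in> {1..k}" for j
    using that unfolding F_def by (intro C.free_gen_closed) (simp add: braid_gens_def)
  have gens'': "free_gen C Kappa0 \<in> carrier F" "free_gen C Kappa1 \<in> carrier F"
    unfolding F_def by (auto intro!: C.free_gen_closed simp: braid_gens_def)
  have rels_F: "free_braid_rels C k \<subseteq> carrier F \<times> carrier F"
    unfolding free_braid_rels_def F_def[symmetric]
    by (rule F.braid_rels_closed) (use gens gens' gens'' in auto)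
  interpret B: ring B
    unfolding B_def braid_algebra_def F_def[symmetric] by (rule F.rel_quot_is_ring[OF rels_F])
  have "braid_class C k \<in> ring_hom F B"
    unfolding B_def braid_algebra_def braid_class_def F_def[symmetric] by (rule F.rel_class_hom[OF rels_F])
  then interpret fb: ring_hom_ring F B "braid_class C k"
    by (rule ring_hom_ringI2[OF F.ring_axioms B.ring_axioms])
  have B_rel: "braid_class C k a = braid_class C k b" if "(a, b) \<in> free_braid_rels C k" for a b
    unfolding braid_class_def F_def[symmetric] by (rule F.rel_class_eq[OF rels_F that])
  have t_B: "braid_t C k w \<in> carrier B" if "w \<in> carrier (sym_group k)" for w
    using gens[OF that] by (simp add: braid_t_def)
  have y_B: "braid_y C k j \<in> carrier B" if "j \<in> {1..k}" for j
    using gens'[OF that] by (simp add: braid_y_def)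
  have scalar_F: "free_scalar C \<in> ring_hom C F"
    unfolding F_def by (rule C.free_scalar_hom)
  \<comment> \<open>Scalars reach the braid algebra through the free algebra; composing once more
    with \<open>cls\<close> gives the ring homomorphism from \<open>C\<close> to \<open>W\<close>
    used for \<epsilon> and for \<open>2\<close>.\<close>
  have scalar_B: "braid_scalar C k \<in> ring_hom C B"
    using ring_hom_trans[OF scalar_F fb.homh]
    by (simp add: braid_scalar_def[abs_def] comp_def)
  then interpret cb: ring_hom_ring C B "braid_scalar C k"
    by (rule ring_hom_ringI2[OF C.ring_axioms B.ring_axioms])
  have e_B: "braid_e C k j \<in> carrier B" if "j \<in> {1..<k}" for j
    using that t_B[OF adj_in_sym_group[OF that]] y_B[of j] y_B[of "j + 1"]
    by (simp add: braid_e_def Let_def flip: B_def)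
  have \<epsilon>_C: "\<epsilon> \<in> carrier C" using assms(3) by auto
  have rels_B: "braid_BMW_rels C \<epsilon> z k \<subseteq> carrier B \<times> carrier B"
    unfolding braid_BMW_rels_def B_def[symmetric]
    by (rule B.BMW_rels_closed) (use \<epsilon>_C assms(4) t_B[OF adj_in_sym_group] y_B e_B in auto)
  interpret W: ring W
    unfolding W_def BMW_algebra_def B_def[symmetric] by (rule B.rel_quot_is_ring[OF rels_B])
  define cls where "cls = BMW_class C \<epsilon> z k"
  have "cls \<in> ring_hom B W"
    unfolding W_def BMW_algebra_def cls_def BMW_class_def B_def[symmetric] by (rule B.rel_class_hom[OF rels_B])
  then interpret bw: ring_hom_ring B W cls
    by (rule ring_hom_ringI2[OF B.ring_axioms W.ring_axioms])
  have W_rel: "cls a = cls b" if "(a, b) \<in> braid_BMW_rels C \<epsilon> z k" for a b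
    unfolding cls_def BMW_class_def B_def[symmetric] by (rule B.rel_class_eq[OF rels_B that])
  define t where "t = braid_t C k (adj i)"
  define p where "p = braid_t C k id"
  define e where "e = braid_e C k i"
  define y where "y = braid_y C k i"
  define y' where "y' = braid_y C k (i + 1)"
  have i: "i \<in> {1..<k}" "i \<in> {1..k}" "i + 1 \<in> {1..k}"
    using assms(5) by (auto simp: k_def)
  have id_S: "id \<in> carrier (sym_group k)"
    using S.one_closed by (simp add: sym_group_one)
  note adj_S = adj_in_sym_group[OF i(1)]
  have carr [simp]: "t \<in> carrier B" "p \<in> carrier B" "e \<in> carrier B" "y \<in> carrier B" "y' \<in> carrier B"
    using t_B[OF adj_S] t_B[OF id_S] e_B y_B i by (auto simp: t_def p_def e_def y_def y'_def)
  have t_mult: "braid_t C k v \<otimes>\<^bsub>B\<^esub> braid_t C k w = braid_t C k (v \<circ> w)"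
    if "v \<in> carrier (sym_group k)" "w \<in> carrier (sym_group k)" for v w
  proof -
    have "(free_gen C (T v) \<otimes>\<^bsub>F\<^esub> free_gen C (T w), free_gen C (T (v \<circ> w))) \<in> free_braid_rels C k"
      unfolding free_braid_rels_def F_def[symmetric]
      using braid_rels.t_t[OF that, of F "\<lambda>w. free_gen C (T w)"] by (simp add: sym_group_mult)
    from B_rel[OF this] show ?thesis
      using gens[OF that(1)] gens[OF that(2)] by (simp add: braid_t_def)
  qed
  \<comment> \<open>\<open>adj i\<close> is an involution, so \<open>t t\<close> is the class
    \<open>p\<close> of the generator for the identity permutation. At this stage \<open>p\<close>
    is only shown to be idempotent and to fix \<open>t\<close>.\<close>
  have p_rels: "p \<otimes>\<^bsub>B\<^esub> p = p" "p \<otimes>\<^bsub>B\<^esub> t = t" "t \<otimes>\<^bsub>B\<^esub> p = t" "t \<otimes>\<^bsub>B\<^esub> t = p"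
    unfolding p_def t_def using id_S adj_S by (simp_all add: t_mult)
  have yy': "y \<otimes>\<^bsub>B\<^esub> y' = y' \<otimes>\<^bsub>B\<^esub> y"
  proof -
    have "(free_gen C (Y i) \<otimes>\<^bsub>F\<^esub> free_gen C (Y (i + 1)), free_gen C (Y (i + 1)) \<otimes>\<^bsub>F\<^esub> free_gen C (Y i))
        \<in> free_braid_rels C k"
      unfolding free_braid_rels_def F_def[symmetric] using i by (intro braid_rels.y_y)
    from B_rel[OF this] show ?thesis
      using gens' i by (simp add: y_def y'_def braid_y_def)
  qed
  have t_sum: "t \<otimes>\<^bsub>B\<^esub> (y \<oplus>\<^bsub>B\<^esub> y') = (y \<oplus>\<^bsub>B\<^esub> y') \<otimes>\<^bsub>B\<^esub> t"
  proof -
    have "(free_gen C (T (adj i)) \<otimes>\<^bsub>F\<^esub> (free_gen C (Y i) \<oplus>\<^bsub>F\<^esub> free_gen C (Y (i + 1))),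
        (free_gen C (Y i) \<oplus>\<^bsub>F\<^esub> free_gen C (Y (i + 1))) \<otimes>\<^bsub>F\<^esub> free_gen C (T (adj i))) \<in> free_braid_rels C k"
      unfolding free_braid_rels_def F_def[symmetric] by (rule braid_rels.t_ysum[OF i(1)])
    from B_rel[OF this] show ?thesis
      using gens[OF adj_S] gens' i by (simp add: t_def y_def y'_def braid_y_def braid_t_def)
  qed
  have e_def': "e = \<one>\<^bsub>B\<^esub> \<ominus>\<^bsub>B\<^esub> (y' \<otimes>\<^bsub>B\<^esub> t \<ominus>\<^bsub>B\<^esub> t \<otimes>\<^bsub>B\<^esub> y)"
    by (simp add: e_def braid_e_def Let_def t_def y_def y'_def flip: B_def)
  have "(e \<otimes>\<^bsub>B\<^esub> t, braid_scalar C k \<epsilon> \<otimes>\<^bsub>B\<^esub> e) \<in> braid_BMW_rels C \<epsilon> z k"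
    unfolding braid_BMW_rels_def B_def[symmetric] e_def t_def by (rule BMW_rels.e_t[OF i(1)])
  from W_rel[OF this] have et: "cls e \<otimes>\<^bsub>W\<^esub> cls t = cls (braid_scalar C k \<epsilon>) \<otimes>\<^bsub>W\<^esub> cls e"
    using \<epsilon>_C by simp
  have "(t \<otimes>\<^bsub>B\<^esub> e, braid_scalar C k \<epsilon> \<otimes>\<^bsub>B\<^esub> e) \<in> braid_BMW_rels C \<epsilon> z k"
    unfolding braid_BMW_rels_def B_def[symmetric] e_def t_def by (rule BMW_rels.t_e[OF i(1)])
  from W_rel[OF this] have te: "cls t \<otimes>\<^bsub>W\<^esub> cls e = cls (braid_scalar C k \<epsilon>) \<otimes>\<^bsub>W\<^esub> cls e"
    using \<epsilon>_C by simp
  have \<epsilon>: "cls (braid_scalar C k \<epsilon>) \<in> {\<one>\<^bsub>W\<^esub>, \<ominus>\<^bsub>W\<^esub> \<one>\<^bsub>W\<^esub>}"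
    using assms(3) by auto
  have hom_minus: "cls (a \<ominus>\<^bsub>B\<^esub> b) = cls a \<ominus>\<^bsub>W\<^esub> cls b" if "a \<in> carrier B" "b \<in> carrier B" for a b
    using that by (simp add: B.minus_eq W.minus_eq)
  have e_W: "cls e = \<one>\<^bsub>W\<^esub> \<ominus>\<^bsub>W\<^esub> (cls y' \<otimes>\<^bsub>W\<^esub> cls t \<ominus>\<^bsub>W\<^esub> cls t \<otimes>\<^bsub>W\<^esub> cls y)"
    by (subst e_def') (simp add: hom_minus)
  \<comment> \<open>The relation \<open>et\<close>, available only after passing to
    \<open>W\<close>, turns the idempotent into the unit, and \<open>t t = p\<close> becomes
    \<open>t t = 1\<close>.\<close>
  have "cls p = \<one>\<^bsub>W\<^esub>"
    by (rule W.BMW_idempotent_eq_one[OF _ _ _ _ _ \<epsilon> _ _ _ et e_W])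
      (use p_rels in \<open>simp_all flip: bw.hom_mult\<close>)
  then have tt: "cls t \<otimes>\<^bsub>W\<^esub> cls t = \<one>\<^bsub>W\<^esub>"
    using p_rels(4) by (simp flip: bw.hom_mult)
  have yy'_W: "cls y \<otimes>\<^bsub>W\<^esub> cls y' = cls y' \<otimes>\<^bsub>W\<^esub> cls y"
    using yy' by (simp flip: bw.hom_mult)
  have t_sum_W: "cls t \<otimes>\<^bsub>W\<^esub> (cls y \<oplus>\<^bsub>W\<^esub> cls y') = (cls y \<oplus>\<^bsub>W\<^esub> cls y') \<otimes>\<^bsub>W\<^esub> cls t"
    using t_sum by (simp flip: bw.hom_mult bw.hom_add)
  \<comment> \<open>The element \<open>2\<close> of \<open>W\<close> is the image of
    \<open>2\<close> in \<open>C\<close> under the scalar homomorphism, and the image of its inverse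
    is a two-sided inverse in \<open>W\<close>.\<close>
  have two: "[(2::nat)] \<cdot>\<^bsub>W\<^esub> \<one>\<^bsub>W\<^esub> \<in> Units W"
  proof -
    let ?\<phi> = "\<lambda>a. cls (braid_scalar C k a)"
    let ?c = "[(2::nat)] \<cdot>\<^bsub>C\<^esub> \<one>\<^bsub>C\<^esub>"
    have c: "?c \<in> carrier C" "inv\<^bsub>C\<^esub> ?c \<in> carrier C"
        "inv\<^bsub>C\<^esub> ?c \<otimes>\<^bsub>C\<^esub> ?c = \<one>\<^bsub>C\<^esub>" "?c \<otimes>\<^bsub>C\<^esub> inv\<^bsub>C\<^esub> ?c = \<one>\<^bsub>C\<^esub>"
      using assms(2) by simp_all
    have "?\<phi> ?c = [(2::nat)] \<cdot>\<^bsub>W\<^esub> \<one>\<^bsub>W\<^esub>"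
      by (simp add: numeral_2_eq_2)
    moreover have "?\<phi> (inv\<^bsub>C\<^esub> ?c) \<otimes>\<^bsub>W\<^esub> ?\<phi> ?c = \<one>\<^bsub>W\<^esub>" "?\<phi> ?c \<otimes>\<^bsub>W\<^esub> ?\<phi> (inv\<^bsub>C\<^esub> ?c) = \<one>\<^bsub>W\<^esub>"
      using c by (simp_all flip: bw.hom_mult cb.hom_mult)
    ultimately show ?thesis
      unfolding Units_def using c(1,2) by (metis (mono_tags, lifting) mem_Collect_eq bw.hom_closed cb.hom_closed)
  qed
  have "cls (braid_scalar C k \<epsilon>) \<in> carrier W" using \<epsilon>_C by simp
  from W.laurent_BMW_identities[OF bw.hom_closed[OF carr(1)] bw.hom_closed[OF carr(3)]
      bw.hom_closed[OF carr(4)] bw.hom_closed[OF carr(5)] this two \<epsilon> tt et te e_W yy'_W t_sum_W]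
  show ?thesis
    unfolding Let_def W_def cls_def t_def e_def y_def y'_def k_def .
qed

end
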